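(* Let $G$ be a graph on $[n]$, let $k$ be a field and let $d$ be a positive integer. If $d\ge \operatorname{tpmd}(G)$, then the twisted LSS-ideal $\hat L_G(d)$ is a radical ideal and a complete intersection.
   Context: Graphs are finite, simple and undirected, with vertex set $V(G)=[n]=\{1,\dots,n\}$ and edge set $E(G)$. For a field $k$ and $d\ge1$, the twisted LSS-ideal of $G$ is the ideal $$\hat L_G(d)=\Big(\hat f_e^{(d)}=\sum_{\ell=1}^d (x_{i,2\ell-1}x_{j,2\ell}-x_{i,2\ell}x_{j,2\ell-1})\ :\ e=\{i,j\}\in E(G),\ i<j\Big)$$ of $S=k[x_{ij}: i\in[n],\ j\in[2d]]$. An ideal is a complete intersection if its minimal number of generators equals its height. Twisted matching decomposition. Let $p$ be a positive integer. A twisted matching decomposition of $G$ is a partition $E(G)=\bigcup_{\ell=1}^{2p}M_\ell$ into pairwise disjoint matchings (sets of pairwise disjoint edges; the sets $M_{2q}$ may be empty) such that for all $q=1,\dots,p$: if $\{i,j\}\in M_{2q-1}$ with $i<j$, then $\{k_1,i\}\notin M_{2q}$ for every $k_1<i$ and $\{j,k_2\}\notin M_{2q}$ for every $k_2>j$. The graphs $H_q$. Given a twisted matching decomposition, for $q=1,\dots,p$ let $H_q$ be the graph with vertex set $\{1_{2q-1},\dots,n_{2q-1},1_{2q},\dots,n_{2q}\}$ whose edges are: $\{i_{2q-1},j_{2q}\}$ for each $\{i,j\}\in M_{2q-1}$ with $i<j$, and $\{j_{2q-1},i_{2q}\}$ for each $\{i,j\}\in M_{2q}$ with $i<j$. Twisted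 positive mapping. A twisted positive mapping on $H_q$ is a function $w:V(H_q)\to\mathbb R$ such that for all $i\ne j$ in $V(G)$: (i) if $\{i_{2q-1},j_{2q}\}\in E(H_q)$, then $w(i_{2q-1})+w(j_{2q})>0$ and $w(j_{2q-1})+w(i_{2q})<0$; (ii) if $\{i,j\}\in E(G)\setminus\bigcup_{k=0}^{2(q-1)}M_k$ (with $M_0=\emptyset$) and neither $\{i_{2q-1},j_{2q}\}$ nor $\{j_{2q-1},i_{2q}\}$ is in $E(H_q)$, then $w(i_{2q-1})+w(j_{2q})<0$ and $w(j_{2q-1})+w(i_{2q})<0$. $G$ admits a twisted positive matching decomposition with $p$ parts, with respect to a twisted matching decomposition $E(G)=\bigcup_{\ell=1}^{2p}M_\ell$, if each $H_q$, $q=1,\dots,p$, has a twisted positive mapping. The number $\operatorname{tpmd}(G)$ is the smallest $p$ for which $G$ admits a twisted positive matching decomposition with $p$ parts. *)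

theory Defs
  imports
    "HOL-Library.Poly_Mapping"
    "HOL-Library.Extended_Nat"
    "HOL-Library.Disjoint_Sets"
    "HOL-Algebra.Ideal"
    Complex_Main
begin

section \<open>Graphs on [n]\<close>

definition graph_on :: "nat \<Rightarrow> nat set set \<Rightarrow> bool" where
  "graph_on n E \<longleftrightarrow> (\<forall>e\<in>E. e \<subseteq> {1..n} \<and> card e = 2)"

definition matching :: "nat set set \<Rightarrow> bool" where
  "matching M \<longleftrightarrow> pairwise disjnt M"


section \<open>Twisted positive matching decompositions\<close>

text \<open>The parts of the partition are allowed to be empty, so that also the graph without
  edges has a decomposition (with p = 1). For a graph with an edge, requiring the parts of odd
  index to be nonempty does not change the least possible p: if the part of index 2q-1 is empty,
  exchange it with the part of index 2q (and exchange the two halves of the mapping w); if both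
  are empty, leave out q.\<close>

definition twisted_matching_decomp :: "nat set set \<Rightarrow> nat \<Rightarrow> (nat \<Rightarrow> nat set set) \<Rightarrow> bool" where
  "twisted_matching_decomp E p M \<longleftrightarrow>
     p \<ge> 1 \<and>
     E = (\<Union>l\<in>{1..2*p}. M l) \<and>
     disjoint_family_on M {1..2*p} \<and>
     (\<forall>l\<in>{1..2*p}. matching (M l)) \<and>
     (\<forall>q\<in>{1..p}. \<forall>i j. i < j \<and> {i,j} \<in> M (2*q-1) \<longrightarrow>
        (\<forall>k1<i. {k1,i} \<notin> M (2*q)) \<and> (\<forall>k2>j. {j,k2} \<notin> M (2*q)))"

text \<open>The vertex written i with index l is the pair (i, l).\<close>

definition H_edges :: "(nat \<Rightarrow> nat set set) \<Rightarrow> nat \<Rightarrow> (nat \<times> nat) set set" where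
  "H_edges M q =
     {{(i, 2*q-1), (j, 2*q)} | i j. i < j \<and> {i,j} \<in> M (2*q-1)} \<union>
     {{(j, 2*q-1), (i, 2*q)} | i j. i < j \<and> {i,j} \<in> M (2*q)}"

text \<open>Only the values of w at the pairs (i, l) with i in [n] and l = 2q-1 or l = 2q matter.\<close>

definition twisted_positive_map ::
  "nat \<Rightarrow> nat set set \<Rightarrow> (nat \<Rightarrow> nat set set) \<Rightarrow> nat \<Rightarrow> (nat \<times> nat \<Rightarrow> real) \<Rightarrow> bool" where
  "twisted_positive_map n E M q w \<longleftrightarrow>
     (\<forall>i\<in>{1..n}. \<forall>j\<in>{1..n}. i \<noteq> j \<longrightarrow>
       ({(i, 2*q-1), (j, 2*q)} \<in> H_edges M q \<longrightarrow>
          w (i, 2*q-1) + w (j, 2*q) > 0 \<and> w (j, 2*q-1) + w (i, 2*q) < 0) \<and>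
       ({i,j} \<in> E - (\<Union>k\<in>{1..2*(q-1)}. M k) \<and>
        {(i, 2*q-1), (j, 2*q)} \<notin> H_edges M q \<and> {(j, 2*q-1), (i, 2*q)} \<notin> H_edges M q \<longrightarrow>
          w (i, 2*q-1) + w (j, 2*q) < 0 \<and> w (j, 2*q-1) + w (i, 2*q) < 0))"

definition admits_tpmd :: "nat \<Rightarrow> nat set set \<Rightarrow> nat \<Rightarrow> bool" where
  "admits_tpmd n E p \<longleftrightarrow>
     (\<exists>M. twisted_matching_decomp E p M \<and> (\<forall>q\<in>{1..p}. \<exists>w. twisted_positive_map n E M q w))"

definition tpmd :: "nat \<Rightarrow> nat set set \<Rightarrow> nat" where
  "tpmd n E = (LEAST p. admits_tpmd n E p)"

text \<open>Every graph admits a decomposition, so the minimum defining tpmd is attained.\<close>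

lemma admits_tpmd_exists:
  assumes "graph_on n E"
  shows "\<exists>p. admits_tpmd n E p"
proof -
  have "E \<subseteq> Pow {1..n}" using assms by (auto simp: graph_on_def)
  then have fin: "finite E" by (rule finite_subset) simp
  obtain f where f: "bij_betw f {1..card E} E"
    using ex_bij_betw_nat_finite_1[OF fin] by blast
  define p where "p = card E + 1"
  define M where "M l = (if odd l \<and> (l + 1) div 2 \<le> card E then {f ((l + 1) div 2)} else {})"
    for l :: nat
  have Modd: "M (2*q-1) = (if q \<le> card E then {f q} else {})" if "q \<ge> 1" for q
    using that by (auto simp: M_def)
  have Meven: "M (2*q) = {}" for q by (auto simp: M_def)
  have finj: "f a = f b \<longleftrightarrow> a = b" if "a \<in> {1..card E}" "b \<in> {1..card E}" for a b
    using inj_on_eq_iff[OF bij_betw_imp_inj_on[OF f]] that by blast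
  have "twisted_matching_decomp E p M"
    unfolding twisted_matching_decomp_def
  proof (intro conjI)
    show "p \<ge> 1" by (simp add: p_def)
    show "E = (\<Union>l\<in>{1..2*p}. M l)"
    proof (intro equalityI subsetI)
      fix e assume "e \<in> E"
      then obtain q where q: "q \<in> {1..card E}" "e = f q"
        using bij_betw_imp_surj_on[OF f] by blast
      then have "e \<in> M (2*q-1)" using Modd[of q] by simp
      moreover have "2*q-1 \<in> {1..2*p}" using q by (auto simp: p_def)
      ultimately show "e \<in> (\<Union>l\<in>{1..2*p}. M l)" by blast
    next
      fix e assume "e \<in> (\<Union>l\<in>{1..2*p}. M l)"
      then obtain l where l: "l \<in> {1..2*p}" "odd l" "(l+1) div 2 \<le> card E" "e = f ((l+1) div 2)"
        by (auto simp: M_def split: if_splits)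
      then have "(l+1) div 2 \<in> {1..card E}" by auto
      then show "e \<in> E" using l(4) bij_betw_imp_surj_on[OF f] by blast
    qed
    show "disjoint_family_on M {1..2*p}"
      unfolding disjoint_family_on_def
    proof (intro ballI impI)
      fix a b assume ab: "a \<in> {1..2*p}" "b \<in> {1..2*p}" "a \<noteq> b"
      show "M a \<inter> M b = {}"
      proof (rule ccontr)
        assume "M a \<inter> M b \<noteq> {}"
        then have *: "odd a" "odd b" "(a+1) div 2 \<in> {1..card E}" "(b+1) div 2 \<in> {1..card E}"
            "f ((a+1) div 2) = f ((b+1) div 2)"
          using ab by (auto simp: M_def split: if_splits)
        then have "(a+1) div 2 = (b+1) div 2" using finj by blast
        with *(1,2) ab(3) show False by (auto elim!: oddE)
      qed
    qed
    show "\<forall>l\<in>{1..2*p}. matching (M l)" by (auto simp: M_def matching_def)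
    show "\<forall>q\<in>{1..p}. \<forall>i j. i < j \<and> {i,j} \<in> M (2*q-1) \<longrightarrow>
        (\<forall>k1<i. {k1,i} \<notin> M (2*q)) \<and> (\<forall>k2>j. {j,k2} \<notin> M (2*q))"
      by (simp add: Meven)
  qed
  moreover have "\<exists>w. twisted_positive_map n E M q w" if q: "q \<in> {1..p}" for q
  proof -
    define w where "w = (\<lambda>(v, l). if \<exists>i j. i < j \<and> {i,j} \<in> M (2*q-1) \<and>
        ((v, l) = (i, 2*q-1) \<or> (v, l) = (j, 2*q)) then 1 else (-3::real))"
    have uniq: "i = i' \<and> j = j'"
      if "i < j" "i' < j'" "{i,j} \<in> M (2*q-1)" "{i',j'} \<in> M (2*q-1)" for i j i' j'
    proof -
      have "{i,j} = {i',j'}" using that q Modd[of q] by (auto split: if_splits)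
      with that(1,2) show ?thesis by (auto simp: doubleton_eq_iff)
    qed
    have neq: "2*q-1 \<noteq> 2*q" using q by auto
    have H: "{(i, 2*q-1), (j, 2*q)} \<in> H_edges M q \<longleftrightarrow> i < j \<and> {i,j} \<in> M (2*q-1)" for i j
      using neq by (auto simp: H_edges_def Meven doubleton_eq_iff)
    have w1: "w (v, 2*q-1) = (if \<exists>j>v. {v,j} \<in> M (2*q-1) then 1 else -3)" for v
      using neq by (auto simp: w_def)
    have w2: "w (v, 2*q) = (if \<exists>i<v. {i,v} \<in> M (2*q-1) then 1 else -3)" for v
      using neq by (auto simp: w_def)
    have neg: "w (i, 2*q-1) + w (j, 2*q) < 0" if "\<not> (i < j \<and> {i,j} \<in> M (2*q-1))" for i j
      using that uniq unfolding w1 w2 by auto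
    have pos: "w (i, 2*q-1) + w (j, 2*q) > 0" if "i < j" "{i,j} \<in> M (2*q-1)" for i j
      using that unfolding w1 w2 by auto
    have "twisted_positive_map n E M q w"
      unfolding twisted_positive_map_def H by (blast intro: neg pos dest: less_asym)
    then show ?thesis by blast
  qed
  ultimately show ?thesis unfolding admits_tpmd_def by blast
qed


section \<open>Ideals in commutative rings\<close>

definition radical_of :: "('a, 'b) ring_scheme \<Rightarrow> 'a set \<Rightarrow> 'a set" where
  "radical_of R I = {x \<in> carrier R. \<exists>m::nat. m \<ge> 1 \<and> x [^]\<^bsub>R\<^esub> m \<in> I}"

definition radical_ideal :: "('a, 'b) ring_scheme \<Rightarrow> 'a set \<Rightarrow> bool" where
  "radical_ideal R I \<longleftrightarrow> ideal I R \<and> radical_of R I = I"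

definition prime_height :: "('a, 'b) ring_scheme \<Rightarrow> 'a set \<Rightarrow> enat" where
  "prime_height R P =
     Sup {enat m | m. \<exists>C. (\<forall>i\<le>m. primeideal (C i) R) \<and> (\<forall>i<m. C i \<subset> C (Suc i)) \<and> C m = P}"

definition ideal_height :: "('a, 'b) ring_scheme \<Rightarrow> 'a set \<Rightarrow> enat" where
  "ideal_height R I = Inf {prime_height R P | P. primeideal P R \<and> I \<subseteq> P}"

definition min_num_gens :: "('a, 'b) ring_scheme \<Rightarrow> 'a set \<Rightarrow> enat" where
  "min_num_gens R I = Inf {enat (card A) | A. finite A \<and> A \<subseteq> carrier R \<and> I = Idl\<^bsub>R\<^esub> A}"

definition complete_intersection :: "('a, 'b) ring_scheme \<Rightarrow> 'a set \<Rightarrow> bool" where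
  "complete_intersection R I \<longleftrightarrow> ideal I R \<and> min_num_gens R I = ideal_height R I"


section \<open>Polynomial rings and the twisted LSS-ideal\<close>

text \<open>A polynomial is a finitely supported map from monomials to coefficients, a monomial
  a finitely supported map from variables to exponents.\<close>

type_synonym ('v, 'k) mpol = "('v \<Rightarrow>\<^sub>0 nat) \<Rightarrow>\<^sub>0 'k"

definition mpol_ring :: "'v set \<Rightarrow> ('v, 'k::field) mpol ring" where
  "mpol_ring V =
     \<lparr>carrier = {f. \<forall>m \<in> Poly_Mapping.keys f. Poly_Mapping.keys m \<subseteq> V},
      mult = (*), one = 1, zero = 0, add = (+)\<rparr>"

lemma cring_mpol_ring: "cring (mpol_ring V :: ('v, 'k::field) mpol ring)"
proof (rule cringI)
  let ?R = "mpol_ring V :: ('v, 'k) mpol ring"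
  have add: "f + g \<in> carrier ?R" if "f \<in> carrier ?R" "g \<in> carrier ?R" for f g
    using that Poly_Mapping.keys_add[of f g] by (fastforce simp: mpol_ring_def)
  have mult: "f * g \<in> carrier ?R" if "f \<in> carrier ?R" "g \<in> carrier ?R" for f g
  proof -
    have "Poly_Mapping.keys m \<subseteq> V" if m: "m \<in> Poly_Mapping.keys (f * g)" for m
    proof -
      obtain a b where ab: "a \<in> Poly_Mapping.keys f" "b \<in> Poly_Mapping.keys g" "m = a + b"
        using keys_mult[of f g] m by blast
      then show ?thesis
        using \<open>f \<in> carrier ?R\<close> \<open>g \<in> carrier ?R\<close> Poly_Mapping.keys_add[of a b]
        by (fastforce simp: mpol_ring_def)
    qed
    then show ?thesis by (simp add: mpol_ring_def)
  qed
  have neg: "- f \<in> carrier ?R" if "f \<in> carrier ?R" for f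
    using that by (simp add: mpol_ring_def)
  have ops: "x \<oplus>\<^bsub>?R\<^esub> y = x + y" "x \<otimes>\<^bsub>?R\<^esub> y = x * y" "\<zero>\<^bsub>?R\<^esub> = 0" "\<one>\<^bsub>?R\<^esub> = 1" for x y
    by (simp_all add: mpol_ring_def)
  have zero: "0 \<in> carrier ?R" and one: "1 \<in> carrier ?R"
    by (auto simp: mpol_ring_def)
  show "abelian_group ?R"
  proof (rule abelian_groupI)
    fix f assume f: "f \<in> carrier ?R"
    show "\<exists>g\<in>carrier ?R. g \<oplus>\<^bsub>?R\<^esub> f = \<zero>\<^bsub>?R\<^esub>"
      using neg[OF f] by (intro bexI[of _ "- f"]) (simp_all add: ops)
  qed (simp_all add: ops add zero add.assoc add.commute)
  show "comm_monoid ?R"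
    by (rule comm_monoidI) (simp_all add: ops mult one mult.assoc mult.commute)
  show "(f \<oplus>\<^bsub>?R\<^esub> g) \<otimes>\<^bsub>?R\<^esub> h = f \<otimes>\<^bsub>?R\<^esub> h \<oplus>\<^bsub>?R\<^esub> g \<otimes>\<^bsub>?R\<^esub> h" for f g h
    by (simp add: ops distrib_right)
qed

definition pvar :: "nat \<Rightarrow> nat \<Rightarrow> (nat \<times> nat, 'k::field) mpol" where
  "pvar i j = Poly_Mapping.single (Poly_Mapping.single (i, j) 1) 1"

definition S_ring :: "nat \<Rightarrow> nat \<Rightarrow> (nat \<times> nat, 'k::field) mpol ring" where
  "S_ring n d = mpol_ring ({1..n} \<times> {1..2*d})"

definition lss_gen :: "nat \<Rightarrow> nat \<Rightarrow> nat \<Rightarrow> (nat \<times> nat, 'k::field) mpol" where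
  "lss_gen d i j =
     (\<Sum>l = 1..d. pvar i (2*l-1) * pvar j (2*l) - pvar i (2*l) * pvar j (2*l-1))"

definition twisted_lss_ideal ::
  "nat \<Rightarrow> nat set set \<Rightarrow> nat \<Rightarrow> (nat \<times> nat, 'k::field) mpol set" where
  "twisted_lss_ideal n E d =
     Idl\<^bsub>S_ring n d\<^esub> {lss_gen d i j | i j. i < j \<and> {i,j} \<in> E}"

text \<open>The generators lie in the ring, so the generated ideal is indeed an ideal of it.\<close>

lemma pvar_in_S_ring:
  assumes "i \<in> {1..n}" "j \<in> {1..2*d}"
  shows "pvar i j \<in> carrier (S_ring n d :: (nat \<times> nat, 'k::field) mpol ring)"
  using assms by (auto simp: pvar_def S_ring_def mpol_ring_def)

lemma lss_gen_in_S_ring: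
  assumes "i \<in> {1..n}" "j \<in> {1..n}"
  shows "lss_gen d i j \<in> carrier (S_ring n d :: (nat \<times> nat, 'k::field) mpol ring)"
proof -
  let ?R = "S_ring n d :: (nat \<times> nat, 'k) mpol ring"
  interpret cring ?R unfolding S_ring_def by (rule cring_mpol_ring)
  have add: "f + g \<in> carrier ?R" and mult: "f * g \<in> carrier ?R"
    if "f \<in> carrier ?R" "g \<in> carrier ?R" for f g
    using a_closed[OF that] m_closed[OF that] by (auto simp: S_ring_def mpol_ring_def)
  have zero: "0 \<in> carrier ?R" and neg: "f \<in> carrier ?R \<Longrightarrow> - f \<in> carrier ?R" for f
    by (auto simp: S_ring_def mpol_ring_def)
  have diff: "f - g \<in> carrier ?R" if "f \<in> carrier ?R" "g \<in> carrier ?R" for f g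
    using add[OF that(1) neg[OF that(2)]] by simp
  have "pvar i (2*l-1) * pvar j (2*l) - pvar i (2*l) * pvar j (2*l-1) \<in> carrier ?R"
    if "l \<in> {1..d}" for l
    using that assms by (intro diff mult pvar_in_S_ring) auto
  then show ?thesis unfolding lss_gen_def
    by (induction rule: infinite_finite_induct[of _ "{1..d}"])
      (auto intro: add zero)
qed

lemma twisted_lss_ideal_is_ideal:
  assumes "graph_on n E"
  shows "ideal (twisted_lss_ideal n E d) (S_ring n d :: (nat \<times> nat, 'k::field) mpol ring)"
proof -
  interpret cring "S_ring n d :: (nat \<times> nat, 'k) mpol ring"
    unfolding S_ring_def by (rule cring_mpol_ring)
  show ?thesis unfolding twisted_lss_ideal_def
    using assms by (intro genideal_ideal) (auto simp: graph_on_def intro!: lss_gen_in_S_ring)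
qed

end

theory Submission
  imports Defs "HOL-Library.Product_Lexorder" "HOL-Algebra.Ring_Divisibility"
begin

text \<open>
  The inequalities of a twisted positive matching decomposition say that the generators have, for a
  suitable monomial order, pairwise coprime squarefree leading monomials. Give the variables of the
  columns 2q-1 and 2q the values of the q-th mapping as weights, and compare monomials by the total
  weight in block 1 first, then by that in block 2, and so on. If the edge e lies in M(2q-1) or
  M(2q), then in every earlier block all monomials of the generator of e have negative weight,
  inside block q exactly one of the two has positive weight, and the monomials of later blocks have
  weight 0 in the blocks up to q. So the monomial of block q picked out by the graph H(q) is the
  leading one (\<open>coprime_leading_lss_gen\<close>). It is a product of two variables; monomials of
  different edges have no variable in common because H(q) is itself a matching, which is what the
  two conditions on a twisted matching decomposition provide (\<open>leads_coprime\<close>).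

  The rest holds for any r homogeneous polynomials of the same degree with pairwise coprime,
  squarefree leading monomials (locale \<open>coprime_leading\<close>). Such polynomials form a Groebner basis
  (\<open>lead_of_gen\<close>): add one generator at a time and reduce its cofactor modulo the previous ones; then
  the leading monomials of the two summands cannot cancel. By division with remainder they also form
  a regular sequence (\<open>nonzerodivisor\<close>). Four consequences give the theorem.

  \<^item> The ideal is radical: if a nonzero remainder h had a power in it, the leading monomial of some
    generator would divide a power of that of h, hence, being squarefree, the leading monomial of h
    itself (\<open>gen_radical\<close>).

  \<^item> Every prime ideal above it has height at least r, because each member of a regular sequence
    allows a step down to a smaller prime ideal (\<open>prime_below_nonzerodivisor\<close>).

  \<^item> Some prime ideal above it has height at most r. Leave out one variable of each leading monomial.
    No nonzero polynomial in the remaining variables B lies in the ideal, so there is a prime ideal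
    above it with this property too. In a chain of m+1 primes ending there, pick an element of each
    prime outside the previous one; these m polynomials and the variables in B are algebraically
    independent. Counting the products with bounded exponents against the monomials of bounded
    degree shows that m + |B| is at most the number of variables (\<open>prime_chain_length\<close>).

  \<^item> It needs at least r generators (\<open>card_generators_ge\<close>): all its members have order at least D,
    the common degree of the given generators, where the order is the lowest degree of a term. So,
    modulo polynomials of order greater than D, any generating set spans it over the field, and r of
    its members are linearly independent.
\<close>

section \<open>Prime ideals avoiding a multiplicative set\<close>

text \<open>An ideal that is maximal among those avoiding T is prime: if a and b lie outside it, then adjoining
  either of them produces an element of T, and the product of the two elements of T would lie in the
  ideal if a times b did.\<close>

lemma (in cring) prime_ideal_avoiding:
  assumes I: "ideal I R" and T: "T \<subseteq> carrier R" "\<one> \<in> T"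
    and mult: "\<And>a b. a \<in> T \<Longrightarrow> b \<in> T \<Longrightarrow> a \<otimes> b \<in> T"
    and disj: "I \<inter> T = {}"
  obtains P where "primeideal P R" "I \<subseteq> P" "P \<inter> T = {}"
proof -
  define S where "S = {J. ideal J R \<and> I \<subseteq> J \<and> J \<inter> T = {}}"
  have "\<exists>P\<in>S. \<forall>J\<in>S. P \<subseteq> J \<longrightarrow> J = P"
  proof (rule subset_Zorn_nonempty)
    show "S \<noteq> {}" using I disj by (auto simp: S_def)
    fix C assume C: "C \<noteq> {}" "subset.chain S C"
    then have "subset.chain {J. ideal J R} C"
      by (auto simp: S_def pred_on.chain_def)
    from chain_Union_is_ideal[OF this] C have "ideal (\<Union>C) R" by simp
    moreover have "C \<subseteq> S" using C(2) by (simp add: pred_on.chain_def)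
    then have "I \<subseteq> \<Union>C" "\<Union>C \<inter> T = {}"
      using C(1) unfolding S_def by blast+
    ultimately show "\<Union>C \<in> S" by (simp add: S_def)
  qed
  then obtain P where PS: "P \<in> S" and maxS: "\<And>J. J \<in> S \<Longrightarrow> P \<subseteq> J \<Longrightarrow> J = P"
    by blast
  then have P: "ideal P R" "I \<subseteq> P" "P \<inter> T = {}"
    by (simp_all add: S_def)
  have max: "J \<inter> T \<noteq> {}" if "ideal J R" "P \<subset> J" for J
    using maxS[of J] that P(2) by (auto simp: S_def)
  interpret P: ideal P R by fact
  have meet: "\<exists>p\<in>P. \<exists>x\<in>carrier R. p \<oplus> x \<otimes> a \<in> T" if a: "a \<in> carrier R" "a \<notin> P" for a
  proof -
    have J: "ideal (P <+>\<^bsub>R\<^esub> PIdl a) R"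
      by (intro add_ideals P(1) cgenideal_ideal a)
    have "p \<in> P <+>\<^bsub>R\<^esub> PIdl a" if "p \<in> P" for p
    proof -
      have "\<zero> \<in> PIdl a" using cgenideal_ideal[OF a(1)]
        by (simp add: additive_subgroup.zero_closed ideal.axioms(1))
      then have "p \<oplus> \<zero> \<in> P <+>\<^bsub>R\<^esub> PIdl a"
        unfolding set_add_def' by (intro UN_I[of p] UN_I[of \<zero>] singletonI that)
      then show ?thesis using P.Icarr[OF that] by simp
    qed
    moreover have "a \<in> P <+>\<^bsub>R\<^esub> PIdl a"
    proof -
      have "a = \<zero> \<oplus> a" using a by simp
      then show ?thesis using cgenideal_self[OF a(1)] P.zero_closed unfolding set_add_def' by auto
    qed
    ultimately have "(P <+>\<^bsub>R\<^esub> PIdl a) \<inter> T \<noteq> {}"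
      using max[OF J] a by auto
    then obtain t where t: "t \<in> P <+>\<^bsub>R\<^esub> PIdl a" "t \<in> T" by auto
    then obtain p b where "p \<in> P" "b \<in> PIdl a" "t = p \<oplus> b" unfolding set_add_def' by auto
    then show ?thesis using t(2) unfolding cgenideal_def by auto
  qed
  have "primeideal P R"
  proof (rule primeidealI)
    show "carrier R \<noteq> P" using P(3) T(2) by auto
    fix a b assume ab: "a \<in> carrier R" "b \<in> carrier R" "a \<otimes> b \<in> P"
    show "a \<in> P \<or> b \<in> P"
    proof (rule ccontr)
      assume "\<not> (a \<in> P \<or> b \<in> P)"
      then have "a \<notin> P" "b \<notin> P" by simp_all
      with meet[OF ab(1)] meet[OF ab(2)] obtain p x q y where
        pq: "p \<in> P" "x \<in> carrier R" "p \<oplus> x \<otimes> a \<in> T" "q \<in> P" "y \<in> carrier R" "q \<oplus> y \<otimes> b \<in> T"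
        by auto
      have [simp]: "p \<in> carrier R" "q \<in> carrier R" using pq P.Icarr by auto
      have "(p \<oplus> x \<otimes> a) \<otimes> (q \<oplus> y \<otimes> b)
          = (q \<oplus> y \<otimes> b) \<otimes> p \<oplus> ((x \<otimes> a) \<otimes> q \<oplus> (x \<otimes> y) \<otimes> (a \<otimes> b))"
        using pq ab by (simp add: r_distr l_distr m_ac a_ac)
      also have "\<dots> \<in> P"
        using pq ab P.I_l_closed[of p "q \<oplus> y \<otimes> b"] P.I_l_closed[of q "x \<otimes> a"]
          P.I_l_closed[of "a \<otimes> b" "x \<otimes> y"] P.a_closed by simp
      finally show False using mult[OF pq(3,6)] P(3) by blast
    qed
  qed (use P is_cring in auto)
  then show thesis using that P by blast
qed

text \<open>The products of elements outside P with powers of f avoid I, because f is no zero divisor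
  modulo I. A prime ideal that avoids all these products lies inside P and does not contain f. Used
  along a regular sequence, this yields a chain of primes without any finiteness condition on the
  ring.\<close>

lemma (in cring) prime_below_nonzerodivisor:
  assumes I: "ideal I R" and P: "primeideal P R" and sub: "I \<subseteq> P" and f: "f \<in> carrier R"
    and nzd: "\<And>s. s \<in> carrier R \<Longrightarrow> f \<otimes> s \<in> I \<Longrightarrow> s \<in> I"
  obtains Q where "primeideal Q R" "I \<subseteq> Q" "Q \<subseteq> P" "f \<notin> Q"
proof -
  interpret P: primeideal P R by fact
  define T where "T = {s \<otimes> f [^] k | s k. s \<in> carrier R - P \<and> (k::nat) \<in> UNIV}"
  have one: "\<one> \<in> carrier R - P"
  proof -
    have "\<one> \<notin> P" using P.one_imp_carrier P.I_notcarr by blast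
    then show ?thesis by simp
  qed
  have TI: "s \<otimes> f [^] k \<in> T" if "s \<in> carrier R - P" for s and k :: nat
    using that by (auto simp: T_def)
  have nzd_pow: "s \<in> I" if "s \<otimes> f [^] k \<in> I" "s \<in> carrier R" for s and k :: nat
    using that(1)
  proof (induction k)
    case 0 then show ?case using that(2) by simp
  next
    case (Suc k)
    have "f \<otimes> (s \<otimes> f [^] k) = s \<otimes> f [^] Suc k"
      using that(2) f by (simp add: m_ac)
    with Suc.prems have "s \<otimes> f [^] k \<in> I" using nzd[of "s \<otimes> f [^] k"] that(2) f by simp
    then show ?case by (rule Suc.IH)
  qed
  obtain Q where Q: "primeideal Q R" "I \<subseteq> Q" "Q \<inter> T = {}"
  proof (rule prime_ideal_avoiding[OF I, of T])
    show "T \<subseteq> carrier R" using f by (auto simp: T_def)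
    show "\<one> \<in> T" using TI[OF one, of 0] by simp
    show "a \<otimes> b \<in> T" if ab: "a \<in> T" "b \<in> T" for a b
    proof -
      obtain s t k l where st: "a = s \<otimes> f [^] (k::nat)" "b = t \<otimes> f [^] (l::nat)"
          "s \<in> carrier R - P" "t \<in> carrier R - P"
        using ab unfolding T_def by blast
      have "a \<otimes> b = (s \<otimes> t) \<otimes> f [^] (k + l)"
        using st f by (simp add: m_ac nat_pow_mult[symmetric])
      moreover have "s \<otimes> t \<in> carrier R - P" using st P.I_prime[of s t] by auto
      ultimately show ?thesis using TI by simp
    qed
    show "I \<inter> T = {}" using nzd_pow sub by (auto simp: T_def)
  qed
  have "f \<notin> Q" using TI[OF one, of 1] f Q(3) by auto
  moreover have "Q \<subseteq> P"
  proof
    fix s assume s: "s \<in> Q"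
    then have "s \<in> carrier R" using ideal.Icarr[OF primeideal.axioms(1)[OF Q(1)]] by blast
    then show "s \<in> P" using TI[of s 0] s Q(3) by auto
  qed
  ultimately show thesis using that Q by blast
qed


section \<open>The polynomial ring\<close>

abbreviation "keys \<equiv> Poly_Mapping.keys"
abbreviation "lookup \<equiv> Poly_Mapping.lookup"
abbreviation "single \<equiv> Poly_Mapping.single"

lemma mpol_ring_simps [simp]:
  "x \<oplus>\<^bsub>mpol_ring V\<^esub> y = x + y" "x \<otimes>\<^bsub>mpol_ring V\<^esub> y = x * y"
  "\<zero>\<^bsub>mpol_ring V\<^esub> = 0" "\<one>\<^bsub>mpol_ring V\<^esub> = 1"
  by (simp_all add: mpol_ring_def)

lemma in_carrier_mpol: "f \<in> carrier (mpol_ring V) \<longleftrightarrow> (\<forall>m\<in>keys f. keys m \<subseteq> V)"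
  by (simp add: mpol_ring_def)

lemma mpol_add_closed:
  "f \<in> carrier (mpol_ring V) \<Longrightarrow> g \<in> carrier (mpol_ring V) \<Longrightarrow> f + g \<in> carrier (mpol_ring V)"
  using Poly_Mapping.keys_add[of f g] by (fastforce simp: in_carrier_mpol)

lemma mpol_uminus_closed: "f \<in> carrier (mpol_ring V) \<Longrightarrow> - f \<in> carrier (mpol_ring V)"
  by (simp add: in_carrier_mpol)

lemma mpol_minus_closed:
  "f \<in> carrier (mpol_ring V) \<Longrightarrow> g \<in> carrier (mpol_ring V) \<Longrightarrow> f - g \<in> carrier (mpol_ring V)"
  using mpol_add_closed[of f V "- g"] mpol_uminus_closed[of g] by simp

lemma mpol_mult_closed:
  fixes f g :: "('v, 'k::field) mpol"
  assumes "f \<in> carrier (mpol_ring V)" "g \<in> carrier (mpol_ring V)"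
  shows "f * g \<in> carrier (mpol_ring V)"
proof -
  interpret cring "mpol_ring V :: ('v, 'k) mpol ring" by (rule cring_mpol_ring)
  show ?thesis using m_closed[OF assms] by simp
qed

lemma mpol_zero_closed [simp]: "0 \<in> carrier (mpol_ring V)"
  and mpol_one_closed [simp]: "1 \<in> carrier (mpol_ring V)"
  by (simp_all add: in_carrier_mpol)

lemma mpol_single_closed: "keys m \<subseteq> V \<Longrightarrow> single m c \<in> carrier (mpol_ring V)"
  by (simp add: in_carrier_mpol)

lemma mpol_const_closed [simp]: "single 0 c \<in> carrier (mpol_ring V)"
  by (simp add: in_carrier_mpol)

lemma mpol_power_closed:
  "f \<in> carrier (mpol_ring V) \<Longrightarrow> f ^ k \<in> carrier (mpol_ring V)"
  by (induction k) (auto intro: mpol_mult_closed)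

lemma mpol_sum_closed:
  "(\<And>x. x \<in> X \<Longrightarrow> g x \<in> carrier (mpol_ring V)) \<Longrightarrow> (\<Sum>x\<in>X. g x) \<in> carrier (mpol_ring V)"
  by (induction X rule: infinite_finite_induct) (auto intro: mpol_add_closed)

lemma mpol_nat_pow: "f [^]\<^bsub>mpol_ring V\<^esub> (k::nat) = f ^ k"
  by (induction k) (simp_all add: mult.commute)

lemmas mpol_closed = mpol_add_closed mpol_minus_closed mpol_uminus_closed mpol_mult_closed
  mpol_power_closed mpol_sum_closed mpol_single_closed

lemma mpol_idealD:
  fixes I :: "('v, 'k::field) mpol set"
  assumes "ideal I (mpol_ring V)"
  shows mpol_ideal_carrier: "a \<in> I \<Longrightarrow> a \<in> carrier (mpol_ring V)"
    and mpol_ideal_zero: "0 \<in> I"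
    and mpol_ideal_add: "a \<in> I \<Longrightarrow> b \<in> I \<Longrightarrow> a + b \<in> I"
    and mpol_ideal_mult: "a \<in> I \<Longrightarrow> s \<in> carrier (mpol_ring V) \<Longrightarrow> s * a \<in> I"
    and mpol_ideal_uminus: "a \<in> I \<Longrightarrow> - a \<in> I"
    and mpol_ideal_minus: "a \<in> I \<Longrightarrow> b \<in> I \<Longrightarrow> a - b \<in> I"
proof -
  note I = ideal.axioms(1)[OF assms]
  show "a \<in> I \<Longrightarrow> a \<in> carrier (mpol_ring V)"
    by (rule ideal.Icarr[OF assms])
  show "0 \<in> I"
    using additive_subgroup.zero_closed[OF I] unfolding mpol_ring_simps .
  show add: "a \<in> I \<Longrightarrow> b \<in> I \<Longrightarrow> a + b \<in> I" for a b
    using additive_subgroup.a_closed[OF I] unfolding mpol_ring_simps .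
  show mult: "a \<in> I \<Longrightarrow> s \<in> carrier (mpol_ring V) \<Longrightarrow> s * a \<in> I" for a s
    using ideal.I_l_closed[OF assms] unfolding mpol_ring_simps .
  show neg: "a \<in> I \<Longrightarrow> - a \<in> I" for a
    using mult[of a "-1"] mpol_uminus_closed[of "1 :: ('v, 'k) mpol" V] by simp
  show "a \<in> I \<Longrightarrow> b \<in> I \<Longrightarrow> a - b \<in> I"
    using add[of a "- b"] neg[of b] by simp
qed

lemma mpol_ideal_sum:
  fixes I :: "('v, 'k::field) mpol set"
  assumes "ideal I (mpol_ring V)" "\<And>x. x \<in> X \<Longrightarrow> g x \<in> I"
  shows "(\<Sum>x\<in>X. g x) \<in> I"
  using assms(2)
  by (induction X rule: infinite_finite_induct)
    (auto intro: mpol_ideal_zero[OF assms(1)] mpol_ideal_add[OF assms(1)])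

lemma mpol_idealI:
  fixes I :: "('v, 'k::field) mpol set"
  assumes "I \<subseteq> carrier (mpol_ring V)" "0 \<in> I" "\<And>a b. a \<in> I \<Longrightarrow> b \<in> I \<Longrightarrow> a + b \<in> I"
    and mult: "\<And>a s. a \<in> I \<Longrightarrow> s \<in> carrier (mpol_ring V) \<Longrightarrow> s * a \<in> I"
  shows "ideal I (mpol_ring V)"
proof -
  interpret cring "mpol_ring V :: ('v, 'k) mpol ring" by (rule cring_mpol_ring)
  show ?thesis
  proof (rule idealI[OF ring_axioms])
    show "subgroup I (add_monoid (mpol_ring V))"
    proof (rule add.subgroupI)
      fix a assume a: "a \<in> I"
      have "\<ominus>\<^bsub>mpol_ring V\<^esub> a = - a"
        by (rule minus_equality) (use a assms(1) in \<open>auto intro: mpol_closed\<close>)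
      then show "\<ominus>\<^bsub>mpol_ring V\<^esub> a \<in> I"
        using mult[OF a, of "-1"] mpol_uminus_closed[of "1 :: ('v, 'k) mpol" V]
        by simp
    qed (use assms in auto)
  qed (use mult in \<open>auto simp: mult.commute\<close>)
qed

lemma mpol_Idl:
  fixes A :: "('v, 'k::field) mpol set"
  assumes "A \<subseteq> carrier (mpol_ring V)"
  shows mpol_Idl_ideal: "ideal (Idl\<^bsub>mpol_ring V\<^esub> A) (mpol_ring V)"
    and mpol_Idl_self: "A \<subseteq> Idl\<^bsub>mpol_ring V\<^esub> A"
    and mpol_Idl_minimal: "ideal J (mpol_ring V) \<Longrightarrow> A \<subseteq> J \<Longrightarrow> Idl\<^bsub>mpol_ring V\<^esub> A \<subseteq> J"
proof -
  interpret cring "mpol_ring V :: ('v, 'k) mpol ring" by (rule cring_mpol_ring)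
  show "ideal (Idl\<^bsub>mpol_ring V\<^esub> A) (mpol_ring V)" "A \<subseteq> Idl\<^bsub>mpol_ring V\<^esub> A"
    using genideal_ideal[OF assms] genideal_self[OF assms] by simp_all
  show "ideal J (mpol_ring V) \<Longrightarrow> A \<subseteq> J \<Longrightarrow> Idl\<^bsub>mpol_ring V\<^esub> A \<subseteq> J"
    by (rule genideal_minimal)
qed

text \<open>This allows proofs by induction on the set of generators.\<close>

lemma mpol_Idl_insert:
  fixes A :: "('v, 'k::field) mpol set"
  assumes A: "A \<subseteq> carrier (mpol_ring V)" and f: "f \<in> carrier (mpol_ring V)"
    and h: "h \<in> Idl\<^bsub>mpol_ring V\<^esub> (insert f A)"
  obtains g s where "g \<in> Idl\<^bsub>mpol_ring V\<^esub> A" "s \<in> carrier (mpol_ring V)" "h = g + s * f"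
proof -
  let ?I = "Idl\<^bsub>mpol_ring V\<^esub> A"
  define J where "J = {h. \<exists>g\<in>?I. \<exists>s\<in>carrier (mpol_ring V). h = g + s * f}"
  have JI: "g + s * f \<in> J" if "g \<in> ?I" "s \<in> carrier (mpol_ring V)" for g s
    using that by (auto simp: J_def)
  note I = mpol_Idl_ideal[OF A]
  have "ideal J (mpol_ring V)"
  proof (rule mpol_idealI)
    show "J \<subseteq> carrier (mpol_ring V)"
      using f mpol_ideal_carrier[OF I] by (auto simp: J_def intro!: mpol_add_closed mpol_mult_closed)
    show "0 \<in> J" using JI[OF mpol_ideal_zero[OF I] mpol_zero_closed] by simp
    fix a assume "a \<in> J"
    then obtain g s where gs: "g \<in> ?I" "s \<in> carrier (mpol_ring V)" "a = g + s * f"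
      by (auto simp: J_def)
    show "t * a \<in> J" if "t \<in> carrier (mpol_ring V)" for t
      using JI[OF mpol_ideal_mult[OF I gs(1) that] mpol_mult_closed[OF that gs(2)]]
      by (simp add: gs algebra_simps)
    fix b assume "b \<in> J"
    then obtain g' s' where gs': "g' \<in> ?I" "s' \<in> carrier (mpol_ring V)" "b = g' + s' * f"
      by (auto simp: J_def)
    show "a + b \<in> J"
      using JI[OF mpol_ideal_add[OF I gs(1) gs'(1)] mpol_add_closed[OF gs(2) gs'(2)]]
      by (simp add: gs gs' algebra_simps)
  qed
  moreover have "f \<in> J" using JI[OF mpol_ideal_zero[OF I] mpol_one_closed] by simp
  moreover have "a \<in> J" if "a \<in> A" for a
    using JI[OF subsetD[OF mpol_Idl_self[OF A] that] mpol_zero_closed] by simp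
  ultimately have "h \<in> J" using mpol_Idl_minimal[of "insert f A" V J] A f h by blast
  then show thesis using that by (auto simp: J_def)
qed

lemma mpol_primeD:
  fixes P :: "('v, 'k::field) mpol set"
  assumes "primeideal P (mpol_ring V)"
  shows mpol_prime_ideal: "ideal P (mpol_ring V)"
    and mpol_prime_mult: "a * b \<in> P \<Longrightarrow> a \<in> carrier (mpol_ring V) \<Longrightarrow> b \<in> carrier (mpol_ring V)
      \<Longrightarrow> a \<in> P \<or> b \<in> P"
proof -
  show "ideal P (mpol_ring V)" by (rule primeideal.axioms(1)[OF assms])
  show "a * b \<in> P \<Longrightarrow> a \<in> carrier (mpol_ring V) \<Longrightarrow> b \<in> carrier (mpol_ring V)
      \<Longrightarrow> a \<in> P \<or> b \<in> P"
    using primeideal.I_prime[OF assms, of a b] unfolding mpol_ring_simps by blast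
qed

lemma sum_terms: "(\<Sum>m\<in>keys h. single m (lookup h m)) = h"
  by (rule poly_mapping_eqI) (auto simp: lookup_sum lookup_single when_def not_in_keys_iff_lookup_eq_zero
      cong: if_cong)


section \<open>Monomials\<close>

definition mdeg :: "('v \<Rightarrow>\<^sub>0 nat) \<Rightarrow> nat" where
  "mdeg m = (\<Sum>v\<in>keys m. lookup m v)"

definition mdvd :: "('v \<Rightarrow>\<^sub>0 nat) \<Rightarrow> ('v \<Rightarrow>\<^sub>0 nat) \<Rightarrow> bool" where
  "mdvd a m \<longleftrightarrow> (\<forall>v. lookup a v \<le> lookup m v)"

lemma mdeg_superset: "finite X \<Longrightarrow> keys m \<subseteq> X \<Longrightarrow> mdeg m = (\<Sum>v\<in>X. lookup m v)"
  unfolding mdeg_def by (rule sum.mono_neutral_left) (auto simp: in_keys_iff)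

lemma mdeg_add: "mdeg (a + b) = mdeg a + mdeg b"
proof -
  let ?X = "keys a \<union> keys b"
  have "keys (a + b) \<subseteq> ?X" by (rule Poly_Mapping.keys_add)
  then show ?thesis
    by (simp add: mdeg_superset[of ?X] lookup_add sum.distrib)
qed

lemma mdeg_single [simp]: "mdeg (single v k) = k"
  by (simp add: mdeg_def)

lemma mdeg_zero [simp]: "mdeg 0 = 0"
  by (simp add: mdeg_def)

lemma lookup_le_mdeg: "lookup m v \<le> mdeg m"
proof (cases "v \<in> keys m")
  case True
  then show ?thesis unfolding mdeg_def by (intro member_le_sum) auto
qed (simp add: in_keys_iff)

lemma mdeg_eq_0: "mdeg m = 0 \<longleftrightarrow> m = 0"
proof
  assume "mdeg m = 0"
  then have "\<And>v. lookup m v = 0" using lookup_le_mdeg[of m] by simp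
  then show "m = 0" by (intro poly_mapping_eqI) simp
qed simp

lemma mdvd_split: "mdvd a m \<Longrightarrow> a + (m - a) = m"
  by (rule poly_mapping_eqI) (simp add: mdvd_def lookup_add lookup_minus)

lemma mdvd_add: "mdvd a (a + b)"
  by (simp add: mdvd_def lookup_add)

lemma keys_add_nat: "keys (a + b :: 'v \<Rightarrow>\<^sub>0 nat) = keys a \<union> keys b"
  by (auto simp: in_keys_iff lookup_add)

text \<open>Coprimality of the leading monomials enters the arguments below through this cancellation.\<close>

lemma mdvd_coprime_cancel:
  assumes "mdvd a (b + m)" "keys a \<inter> keys b = {}"
  shows "mdvd a m"
  unfolding mdvd_def
proof
  fix v
  show "lookup a v \<le> lookup m v"
  proof (cases "v \<in> keys a")
    case True
    then have "lookup b v = 0" using assms(2) by (auto simp: in_keys_iff)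
    then show ?thesis using assms(1) by (auto simp: mdvd_def lookup_add dest: spec[of _ v])
  qed (simp add: in_keys_iff)
qed

lemma monomials_bounded_degree:
  assumes "finite V"
  shows finite_monomials: "finite {m. keys m \<subseteq> V \<and> mdeg m \<le> T}"
    and card_monomials: "card {m. keys m \<subseteq> V \<and> mdeg m \<le> T} \<le> Suc T ^ card V"
proof -
  let ?M = "{m. keys m \<subseteq> V \<and> mdeg m \<le> T}"
  let ?F = "V \<rightarrow>\<^sub>E {..T}"
  let ?r = "\<lambda>m :: 'a \<Rightarrow>\<^sub>0 nat. restrict (lookup m) V"
  have fin: "finite ?F" by (intro finite_PiE assms) auto
  have sub: "?r ` ?M \<subseteq> ?F"
    using order_trans[OF lookup_le_mdeg] by (auto simp: PiE_iff)
  have inj: "inj_on ?r ?M"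
  proof (rule inj_onI)
    fix a b assume ab: "a \<in> ?M" "b \<in> ?M" "?r a = ?r b"
    show "a = b"
    proof (rule poly_mapping_eqI)
      fix v
      show "lookup a v = lookup b v"
      proof (cases "v \<in> V")
        case True then show ?thesis using fun_cong[OF ab(3), of v] by simp
      next
        case False
        then have "v \<notin> keys a" "v \<notin> keys b" using ab by auto
        then show ?thesis by (simp add: in_keys_iff)
      qed
    qed
  qed
  show "finite ?M" by (rule inj_on_finite[OF inj sub fin])
  have "card ?M \<le> card ?F" by (rule card_inj_on_le[OF inj sub fin])
  then show "card ?M \<le> Suc T ^ card V" by (simp add: card_PiE assms)
qed


lemma keys_multE:
  assumes "k \<in> keys (f * g :: ('v, 'k::field) mpol)"
  obtains x y where "k = x + y" "x \<in> keys f" "y \<in> keys g"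
  using subsetD[OF keys_mult assms] by blast


section \<open>Leading monomials\<close>

text \<open>All that is needed of a monomial order is that it is total (the values in a linear order determine
  the monomial) and compatible with multiplication. Well-foundedness is replaced by the finiteness of
  the set of monomials of a given degree, since the polynomials divided by are homogeneous; this
  admits orders given by weights of either sign.\<close>

locale monomial_order =
  fixes ord :: "('v::linorder \<Rightarrow>\<^sub>0 nat) \<Rightarrow> 'o::linorder"
  assumes ord_inj: "ord a = ord b \<Longrightarrow> a = b"
    and ord_add: "ord a < ord b \<Longrightarrow> ord (a + c) < ord (b + c)"
begin

definition is_lead :: "('v, 'k::field) mpol \<Rightarrow> ('v \<Rightarrow>\<^sub>0 nat) \<Rightarrow> bool" where
  "is_lead h m \<longleftrightarrow> m \<in> keys h \<and> (\<forall>k\<in>keys h. k \<noteq> m \<longrightarrow> ord k < ord m)"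

lemma ord_add_mono:
  assumes "ord a \<le> ord a'" "ord b < ord b'"
  shows "ord (a + b) < ord (a' + b')"
proof -
  have "ord (a' + b) < ord (a' + b')" using ord_add[OF assms(2), of a'] by (simp add: add.commute)
  moreover have "ord (a + b) \<le> ord (a' + b)"
  proof (cases "a = a'")
    case False
    then have "ord a \<noteq> ord a'" using ord_inj by blast
    then have "ord a < ord a'" using assms(1) by simp
    then show ?thesis using ord_add[of a a' b] by simp
  qed simp
  ultimately show ?thesis by simp
qed

lemma lead_exists:
  assumes "h \<noteq> 0"
  obtains m where "is_lead h m"
proof -
  have "Max (ord ` keys h) \<in> ord ` keys h" using assms by (intro Max_in) auto
  then obtain m where m: "m \<in> keys h" "ord m = Max (ord ` keys h)" by auto
  have "ord k < ord m" if "k \<in> keys h" "k \<noteq> m" for k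
  proof -
    have "ord k \<le> ord m" using that m by simp
    then show ?thesis using that(2) ord_inj[of k m] by (auto simp: order_less_le)
  qed
  then show thesis using that[of m] m(1) by (simp add: is_lead_def)
qed

lemma lead_unique: "is_lead h a \<Longrightarrow> is_lead h b \<Longrightarrow> a = b"
  unfolding is_lead_def by (metis less_asym)

lemma lead_nonzero: "is_lead h m \<Longrightarrow> h \<noteq> 0"
  by (auto simp: is_lead_def)

lemma lead_add:
  assumes "is_lead g a" "\<And>k. k \<in> keys h \<Longrightarrow> ord k < ord a"
  shows "is_lead (g + h) a"
proof -
  have "a \<notin> keys h" using assms(2) by blast
  then have "a \<in> keys (g + h)" using assms(1) by (auto simp: is_lead_def in_keys_iff lookup_add)
  then show ?thesis
    using assms Poly_Mapping.keys_add[of g h] unfolding is_lead_def by blast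
qed

lemma lead_tail:
  assumes "is_lead h m"
  obtains c h' where "h = single m c + h'" "c \<noteq> 0"
    "\<forall>k\<in>keys h'. k \<in> keys h \<and> ord k < ord m"
proof -
  let ?t = "h - single m (lookup h m)"
  have "h = single m (lookup h m) + ?t" by simp
  moreover have "k \<in> keys h \<and> ord k < ord m" if "k \<in> keys ?t" for k
  proof -
    have "k \<noteq> m" "k \<in> keys h"
      using that by (auto simp: in_keys_iff lookup_minus lookup_single when_def split: if_splits)
    then show ?thesis using assms by (simp add: is_lead_def)
  qed
  moreover have "lookup h m \<noteq> 0" using assms by (simp add: is_lead_def in_keys_iff)
  ultimately show thesis using that by blast
qed

lemma lead_mult:
  assumes "is_lead f a" "is_lead g b"
  shows "is_lead (f * g) (a + b)"
proof -
  obtain c f' where f: "f = single a c + f'" "c \<noteq> 0" "\<forall>k\<in>keys f'. k \<in> keys f \<and> ord k < ord a"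
    using lead_tail[OF assms(1)] .
  obtain d g' where g: "g = single b d + g'" "d \<noteq> 0" "\<forall>k\<in>keys g'. k \<in> keys g \<and> ord k < ord b"
    using lead_tail[OF assms(2)] .
  have "f * g = f * single b d + f * g'" unfolding g(1) by (rule distrib_left)
  also have "f * single b d = single (a + b) (c * d) + f' * single b d"
    unfolding f(1) distrib_right mult_single ..
  finally have eq: "f * g = single (a + b) (c * d) + (f' * single b d + f * g')"
    by (simp only: add.assoc)
  have "is_lead (single (a + b) (c * d)) (a + b)" using f(2) g(2) by (simp add: is_lead_def)
  moreover have "ord k < ord (a + b)" if k: "k \<in> keys (f' * single b d + f * g')" for k
  proof -
    have "k \<in> keys (f' * single b d) \<or> k \<in> keys (f * g')"
      using subsetD[OF Poly_Mapping.keys_add k] by blast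
    then show ?thesis
    proof
      assume "k \<in> keys (f' * single b d)"
      then obtain x y where "k = x + y" "x \<in> keys f'" "y \<in> keys (single b d)"
        by (rule keys_multE)
      then show ?thesis using f(3) ord_add[of x a b] by (simp split: if_splits)
    next
      assume "k \<in> keys (f * g')"
      then obtain x y where xy: "k = x + y" "x \<in> keys f" "y \<in> keys g'"
        by (rule keys_multE)
      have "ord x \<le> ord a"
        using assms(1) xy(2) unfolding is_lead_def by (metis order.order_iff_strict)
      then show ?thesis using ord_add_mono[of x a y b] g(3) xy(1,3) by simp
    qed
  qed
  ultimately show ?thesis unfolding eq by (rule lead_add)
qed

lemma lead_power:
  fixes h :: "('v, 'k::field) mpol"
  assumes "is_lead h m"
  obtains m' where "is_lead (h ^ N) m'" "\<And>v. lookup m' v = N * lookup m v"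
proof -
  have "\<exists>m'. is_lead (h ^ N) m' \<and> (\<forall>v. lookup m' v = N * lookup m v)"
  proof (induction N)
    case 0
    have "is_lead (1 :: ('v, 'k) mpol) 0" by (simp add: is_lead_def)
    then show ?case by (auto intro!: exI[of _ 0])
  next
    case (Suc N)
    then obtain m' where "is_lead (h ^ N) m'" "\<And>v. lookup m' v = N * lookup m v" by blast
    then have "is_lead (h ^ Suc N) (m + m')" "\<And>v. lookup (m + m') v = Suc N * lookup m v"
      using lead_mult[OF assms] by (simp_all add: lookup_add)
    then show ?case by blast
  qed
  then show thesis using that by blast
qed

end


section \<open>Generators with coprime squarefree leading monomials\<close>

locale coprime_leading = monomial_order ord
  for ord :: "('v::linorder \<Rightarrow>\<^sub>0 nat) \<Rightarrow> 'o::linorder" +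
  fixes V :: "'v set" and E :: "'e set" and f :: "'e \<Rightarrow> ('v, 'k::field) mpol"
    and u :: "'e \<Rightarrow> ('v \<Rightarrow>\<^sub>0 nat)" and D :: nat
  assumes finite_V: "finite V" and finite_E: "finite E"
    and f_carrier: "e \<in> E \<Longrightarrow> f e \<in> carrier (mpol_ring V)"
    and f_lead: "e \<in> E \<Longrightarrow> is_lead (f e) (u e)"
    and f_homogeneous: "e \<in> E \<Longrightarrow> m \<in> keys (f e) \<Longrightarrow> mdeg m = D"
    and D_pos: "D > 0"
    and u_squarefree: "e \<in> E \<Longrightarrow> lookup (u e) v \<le> 1"
    and u_coprime: "e \<in> E \<Longrightarrow> e' \<in> E \<Longrightarrow> e \<noteq> e' \<Longrightarrow> keys (u e) \<inter> keys (u e') = {}"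
begin

abbreviation "R \<equiv> mpol_ring V :: ('v, 'k) mpol ring"

definition gen :: "'e set \<Rightarrow> ('v, 'k) mpol set" where
  "gen F = Idl\<^bsub>R\<^esub> (f ` F)"

definition standard :: "'e set \<Rightarrow> ('v, 'k) mpol \<Rightarrow> bool" where
  "standard F h \<longleftrightarrow> (\<forall>m\<in>keys h. \<forall>e\<in>F. \<not> mdvd (u e) m)"

lemma f_image: "F \<subseteq> E \<Longrightarrow> f ` F \<subseteq> carrier R"
  using f_carrier by auto

lemma gen_ideal: "F \<subseteq> E \<Longrightarrow> ideal (gen F) R"
  unfolding gen_def by (rule mpol_Idl_ideal[OF f_image])

lemma f_in_gen: "F \<subseteq> E \<Longrightarrow> e \<in> F \<Longrightarrow> f e \<in> gen F"
  unfolding gen_def using mpol_Idl_self[OF f_image] by blast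

lemma standard_add: "standard F g \<Longrightarrow> standard F h \<Longrightarrow> standard F (g + h)"
  unfolding standard_def using subsetD[OF Poly_Mapping.keys_add[of g h]] by blast

lemma standard_const_mult: 
  assumes "standard F h"
  shows "standard F (single 0 c * h)"
  unfolding standard_def
proof
  fix m assume "m \<in> keys (single 0 c * h)"
  then obtain x y where xy: "m = x + y" "x \<in> keys (single 0 c)" "y \<in> keys h" by (rule keys_multE)
  then have "m = y" by (simp split: if_splits)
  then show "\<forall>e\<in>F. \<not> mdvd (u e) m" using xy(3) assms by (simp add: standard_def)
qed

text \<open>Division with remainder is linear, so it suffices to divide monomials.\<close>

lemma standard_combination:
  assumes F: "F \<subseteq> E" and h: "h \<in> carrier R"
    and terms: "\<And>m. m \<in> keys h \<Longrightarrow> \<exists>s\<in>carrier R. standard F s \<and> single m 1 - s \<in> gen F"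
  shows "\<exists>s\<in>carrier R. standard F s \<and> h - s \<in> gen F"
proof -
  note I = gen_ideal[OF F]
  obtain s where s: "\<forall>m\<in>keys h. s m \<in> carrier R \<and> standard F (s m) \<and> single m 1 - s m \<in> gen F"
    using bchoice[of "keys h" "\<lambda>m s. s \<in> carrier R \<and> standard F s \<and> single m 1 - s \<in> gen F"] terms
    by blast
  let ?s = "\<Sum>m\<in>keys h. single 0 (lookup h m) * s m"
  have "?s \<in> carrier R" using s by (intro mpol_sum_closed mpol_mult_closed) auto
  moreover have "standard F (\<Sum>m\<in>X. single 0 (lookup h m) * s m)" if "X \<subseteq> keys h" for X
    using finite_subset[OF that] that
  proof (induction X rule: infinite_finite_induct)
    case (insert m X)
    then show ?case using s by (simp add: standard_add standard_const_mult)
  qed (simp_all add: standard_def)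
  moreover have "h - ?s \<in> gen F"
  proof -
    have "h = (\<Sum>m\<in>keys h. single 0 (lookup h m) * single m 1)"
      using sum_terms[of h] by (simp add: mult_single)
    then have "h - ?s = (\<Sum>m\<in>keys h. single 0 (lookup h m) * (single m 1 - s m))"
      by (metis (no_types, lifting) right_diff_distrib sum.cong sum_subtractf)
    also have "\<dots> \<in> gen F"
      using s by (intro mpol_ideal_sum[OF I] mpol_ideal_mult[OF I]) auto
    finally show ?thesis .
  qed
  ultimately show ?thesis by blast
qed

text \<open>Replacing a leading monomial inside m by the tail of its generator keeps the degree, as the
  generators are homogeneous, and lowers all monomials in the order. There are only finitely many
  lower monomials of the same degree in the variables V, and their number is the measure of the
  induction.\<close>

lemma division_monomial:
  assumes F: "F \<subseteq> E" and "keys m \<subseteq> V"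
  shows "\<exists>s\<in>carrier R. standard F s \<and> single m 1 - s \<in> gen F"
  using assms(2)
proof (induction "card {k. keys k \<subseteq> V \<and> mdeg k = mdeg m \<and> ord k < ord m}" arbitrary: m
    rule: less_induct)
  case less
  note I = gen_ideal[OF F]
  let ?L = "\<lambda>m. {k. keys k \<subseteq> V \<and> mdeg k = mdeg m \<and> ord k < ord m}"
  show ?case
  proof (cases "standard F (single m 1)")
    case True
    then show ?thesis
      using mpol_single_closed[OF less.prems] mpol_ideal_zero[OF I]
      by (intro bexI[of _ "single m 1"]) auto
  next
    case False
    then obtain e where e: "e \<in> F" "mdvd (u e) m" by (auto simp: standard_def)
    define t where "t = m - u e"
    have m: "m = u e + t" using mdvd_split[OF e(2)] by (simp add: t_def)
    have eE: "e \<in> E" using e F by blast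
    obtain c g where g: "f e = single (u e) c + g" "c \<noteq> 0"
      "\<forall>k\<in>keys g. k \<in> keys (f e) \<and> ord k < ord (u e)"
      by (rule lead_tail[OF f_lead[OF eE]])
    define h where "h = single t (- 1 / c) * g"
    have h_eq: "single m 1 - h = single t (1 / c) * f e"
      unfolding h_def g(1) m using g(2)
      by (simp add: distrib_left mult_single single_uminus add.commute)
    have u_V: "keys (u e) \<subseteq> V" and t_V: "keys t \<subseteq> V"
      using less.prems by (simp_all add: m keys_add_nat)
    have h_keys: "keys k \<subseteq> V \<and> mdeg k = mdeg m \<and> ord k < ord m" if k: "k \<in> keys h" for k
    proof -
      obtain x y where xy: "k = x + y" "x \<in> keys (single t (- 1 / c))" "y \<in> keys g"
        using k unfolding h_def by (rule keys_multE)
      then have k_eq: "k = t + y" by (simp split: if_splits)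
      have y: "y \<in> keys (f e)" "ord y < ord (u e)" using g(3) xy(3) by auto
      have "keys y \<subseteq> V" using y(1) f_carrier[OF eE] by (auto simp: in_carrier_mpol)
      moreover have "mdeg y = mdeg (u e)"
        using f_homogeneous[OF eE] y(1) f_lead[OF eE] by (simp add: is_lead_def)
      ultimately show ?thesis
        using ord_add[OF y(2), of t] t_V by (simp add: k_eq m keys_add_nat mdeg_add add.commute)
    qed
    have "\<exists>s\<in>carrier R. standard F s \<and> h - s \<in> gen F"
    proof (rule standard_combination[OF F])
      show "h \<in> carrier R" using h_keys by (simp add: in_carrier_mpol)
      fix k assume "k \<in> keys h"
      note k = h_keys[OF this]
      have "finite (?L m)"
        by (rule finite_subset[OF _ finite_monomials[OF finite_V, of "mdeg m"]]) auto
      moreover have "?L k \<subset> ?L m" using k by (auto intro: less_trans)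
      ultimately have "card (?L k) < card (?L m)" by (rule psubset_card_mono)
      then show "\<exists>s\<in>carrier R. standard F s \<and> single k 1 - s \<in> gen F"
        using less.hyps k by blast
    qed
    then obtain s where s: "s \<in> carrier R" "standard F s" "h - s \<in> gen F" by blast
    have "(single m 1 - h) + (h - s) \<in> gen F"
      unfolding h_eq
      by (intro mpol_ideal_add[OF I] mpol_ideal_mult[OF I] f_in_gen F e s mpol_single_closed t_V)
    then show ?thesis using s by auto
  qed
qed

lemma division:
  assumes "F \<subseteq> E" "h \<in> carrier R"
  obtains s where "s \<in> carrier R" "standard F s" "h - s \<in> gen F"
  using standard_combination[OF assms division_monomial[OF assms(1)]] assms(2)
  by (auto simp: in_carrier_mpol)

text \<open>This says that the generators form a Groebner basis. When e is added to F, write a member of the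
  ideal as g' + r f(e) with g' in the ideal of F and r standard with respect to F. The leading
  monomial of r f(e) is not divisible by any u(e') with e' in F: such a u(e'), being coprime to u(e),
  would divide the leading monomial of r. That of g' is divisible by one of them. So the two leading
  monomials differ, and the larger one is the leading monomial of the sum.\<close>

lemma lead_of_gen:
  assumes "F \<subseteq> E" "h \<in> gen F" "is_lead h m"
  shows "\<exists>e\<in>F. mdvd (u e) m"
proof -
  have "finite F" using assms(1) finite_E by (rule finite_subset)
  then show ?thesis using assms
  proof (induction F arbitrary: h m rule: finite_induct)
    case empty
    have "gen {} \<subseteq> {0}"
      unfolding gen_def image_empty by (rule mpol_Idl_minimal) (auto intro!: mpol_idealI)
    then show ?case using empty by (auto dest: lead_nonzero)
  next
    case (insert e F)
    then have F: "F \<subseteq> E" and e: "e \<in> E" by auto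
    note I = gen_ideal[OF F]
    obtain g s where gs: "g \<in> gen F" "s \<in> carrier R" "h = g + s * f e"
      using mpol_Idl_insert[OF f_image[OF F] f_carrier[OF e], of h] insert.prems(2)
      unfolding gen_def by auto
    obtain r where r: "r \<in> carrier R" "standard F r" "s - r \<in> gen F"
      using division[OF F gs(2)] .
    define g' where "g' = g + f e * (s - r)"
    have h: "h = g' + r * f e" by (simp add: g'_def gs(3) algebra_simps)
    have g': "g' \<in> gen F"
      unfolding g'_def
      by (intro mpol_ideal_add[OF I] mpol_ideal_mult[OF I] gs r f_carrier e)
    show ?case
    proof (cases "r = 0")
      case True
      then show ?thesis using insert.IH[OF F g', of m] insert.prems(3) h by auto
    next
      case False
      then obtain b where b: "is_lead r b" by (rule lead_exists)
      have re: "is_lead (r * f e) (b + u e)" by (rule lead_mult[OF b f_lead[OF e]])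
      have not_F: "\<not> mdvd (u e') (b + u e)" if "e' \<in> F" for e'
      proof
        assume "mdvd (u e') (b + u e)"
        then have "mdvd (u e') (u e + b)" by (simp add: add.commute)
        moreover have "keys (u e') \<inter> keys (u e) = {}"
          using that F e insert.hyps(2) by (intro u_coprime) auto
        ultimately have "mdvd (u e') b" by (rule mdvd_coprime_cancel)
        then show False using r(2) b that by (auto simp: standard_def is_lead_def)
      qed
      have dvd_e: "mdvd (u e) (b + u e)" using mdvd_add[of "u e" b] by (simp add: add.commute)
      show ?thesis
      proof (cases "g' = 0")
        case True
        then have "m = b + u e" using lead_unique[OF insert.prems(3)] re h by simp
        then show ?thesis using dvd_e by blast
      next
        case False
        then obtain a where a: "is_lead g' a" by (rule lead_exists)
        obtain e' where e': "e' \<in> F" "mdvd (u e') a" using insert.IH[OF F g' a] by blast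
        then have "a \<noteq> b + u e" using not_F by blast
        then have "ord a \<noteq> ord (b + u e)" using ord_inj by blast
        then consider "ord (b + u e) < ord a" | "ord a < ord (b + u e)" by (auto simp: neq_iff)
        then show ?thesis
        proof cases
          case 1
          have "is_lead h a" unfolding h
            by (rule lead_add[OF a]) (use 1 re in \<open>auto simp: is_lead_def\<close>)
          then have "m = a" by (rule lead_unique[OF insert.prems(3)])
          then show ?thesis using e' by blast
        next
          case 2
          have "is_lead (r * f e + g') (b + u e)"
            by (rule lead_add[OF re]) (use 2 a in \<open>auto simp: is_lead_def\<close>)
          then have "m = b + u e"
            using lead_unique[OF insert.prems(3)] h by (simp add: add.commute)
          then show ?thesis using dvd_e by blast
        qed
      qed
    qed
  qed
qed

text \<open>The generators form a regular sequence in any order. By division s may be taken standard; if it is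
  not 0, some u(e') divides the leading monomial of f(e) s, and hence, by coprimality, that of s.\<close>

lemma nonzerodivisor:
  assumes F: "F \<subseteq> E" and e: "e \<in> E" "e \<notin> F" and s: "s \<in> carrier R" "f e * s \<in> gen F"
  shows "s \<in> gen F"
proof -
  note I = gen_ideal[OF F]
  obtain r where r: "r \<in> carrier R" "standard F r" "s - r \<in> gen F"
    using division[OF F s(1)] .
  have "f e * s - f e * (s - r) \<in> gen F"
    by (intro mpol_ideal_minus[OF I] mpol_ideal_mult[OF I] s r f_carrier e)
  then have fr: "f e * r \<in> gen F" by (simp add: algebra_simps)
  have "r = 0"
  proof (rule ccontr)
    assume "r \<noteq> 0"
    then obtain b where b: "is_lead r b" by (rule lead_exists)
    obtain e' where e': "e' \<in> F" "mdvd (u e') (u e + b)"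
      using lead_of_gen[OF F fr lead_mult[OF f_lead[OF e(1)] b]] by blast
    have "keys (u e') \<inter> keys (u e) = {}"
      using e' F e by (intro u_coprime) auto
    with e'(2) have "mdvd (u e') b" by (rule mdvd_coprime_cancel)
    then show False using r(2) b e'(1) by (auto simp: standard_def is_lead_def)
  qed
  then show ?thesis using r(3) by simp
qed

text \<open>The remainder r of h has its N-th power in the ideal as well. If r were not 0, some u(e) would divide
  the N-th power of the leading monomial of r, and then, being squarefree, this monomial itself.\<close>

theorem gen_radical:
  assumes h: "h \<in> carrier R" "h ^ N \<in> gen E"
  shows "h \<in> gen E"
proof -
  note I = gen_ideal[OF subset_refl]
  obtain r where r: "r \<in> carrier R" "standard E r" "h - r \<in> gen E"
    using division[OF subset_refl h(1)] .
  have "r ^ k - h ^ k \<in> gen E" for k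
  proof (induction k)
    case 0 then show ?case using mpol_ideal_zero[OF I] by simp
  next
    case (Suc k)
    have "r ^ Suc k - h ^ Suc k = r * (r ^ k - h ^ k) - h ^ k * (h - r)"
      by (simp add: algebra_simps)
    also have "\<dots> \<in> gen E"
      by (intro mpol_ideal_minus[OF I] mpol_ideal_mult[OF I Suc] mpol_ideal_mult[OF I r(3)]
          mpol_power_closed r(1) h(1))
    finally show ?case .
  qed
  from mpol_ideal_add[OF I this[of N] h(2)] have rN: "r ^ N \<in> gen E" by simp
  have "r = 0"
  proof (rule ccontr)
    assume "r \<noteq> 0"
    then obtain b where b: "is_lead r b" by (rule lead_exists)
    obtain b' where b': "is_lead (r ^ N) b'" "\<And>v. lookup b' v = N * lookup b v"
      using lead_power[OF b] by blast
    obtain e where e: "e \<in> E" "mdvd (u e) b'" using lead_of_gen[OF subset_refl rN b'(1)] by blast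
    have "mdvd (u e) b"
      unfolding mdvd_def
    proof
      fix v
      have "lookup (u e) v \<le> N * lookup b v" using e(2) b'(2) by (simp add: mdvd_def)
      then show "lookup (u e) v \<le> lookup b v"
        using u_squarefree[OF e(1), of v] by (cases "lookup b v") auto
    qed
    then show False using r(2) b e(1) by (auto simp: standard_def is_lead_def)
  qed
  then show ?thesis using r(3) by simp
qed

end


section \<open>Linear independence modulo an ideal\<close>

interpretation mpol_vs: vector_space "\<lambda>(c :: 'k::field) (h :: ('v, 'k) mpol). single 0 c * h"
  by unfold_locales (simp_all add: algebra_simps single_add mult_single single_one flip: mult.assoc)

text \<open>The family x is linearly independent over the field modulo P. Families rather than sets are used,
  as products of elements need not be distinct a priori.\<close>

definition indep_mod :: "('v, 'k::field) mpol set \<Rightarrow> 'i set \<Rightarrow> ('i \<Rightarrow> ('v, 'k) mpol) \<Rightarrow> bool" where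
  "indep_mod P J x \<longleftrightarrow> (\<forall>c. (\<Sum>j\<in>J. single 0 (c j) * x j) \<in> P \<longrightarrow> (\<forall>j\<in>J. c j = 0))"

lemma indep_modD:
  "indep_mod P J x \<Longrightarrow> (\<Sum>j\<in>J. single 0 (c j) * x j) \<in> P \<Longrightarrow> j \<in> J \<Longrightarrow> c j = 0"
  unfolding indep_mod_def by blast

lemma indep_mod_inj:
  fixes x :: "'i \<Rightarrow> ('v, 'k::field) mpol"
  assumes x: "indep_mod P J x" and J: "finite J" and "0 \<in> P"
  shows "inj_on x J"
proof (rule inj_onI, rule ccontr)
  fix i j assume ij: "i \<in> J" "j \<in> J" "x i = x j" "i \<noteq> j"
  let ?c = "\<lambda>l. if l = i then 1 else if l = j then - 1 else (0 :: 'k)"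
  have "(\<Sum>l\<in>J. single 0 (?c l) * x l) = (\<Sum>l\<in>J. (if l = i then x i else 0) + (if l = j then - x j else 0))"
    using ij(4) by (intro sum.cong) (auto simp: single_uminus single_one)
  also have "\<dots> = 0" using J ij by (simp add: sum.distrib)
  finally have "?c i = 0" using indep_modD[OF x, of ?c i] ij(1) assms(3) by simp
  then show False by simp
qed

lemma card_le_of_independent:
  fixes x :: "'i \<Rightarrow> ('v, 'k::field) mpol"
  assumes x: "indep_mod {0} J x" and "finite J" and "finite A"
    and span: "\<And>j. j \<in> J \<Longrightarrow> x j \<in> mpol_vs.span A"
  shows "card J \<le> card A"
proof -
  have inj: "inj_on x J" using x assms(2) by (rule indep_mod_inj) simp
  have "mpol_vs.independent (x ` J)"
  proof (rule mpol_vs.independent_if_scalars_zero)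
    show "finite (x ` J)" using assms(2) by simp
    fix c y assume c: "(\<Sum>y\<in>x ` J. single 0 (c y) * y) = 0" and "y \<in> x ` J"
    then obtain j where "j \<in> J" "y = x j" by blast
    then show "c y = 0"
      using indep_modD[OF x, of "\<lambda>j. c (x j)"] c by (simp add: sum.reindex[OF inj])
  qed
  then have "card (x ` J) \<le> card A"
    using mpol_vs.independent_span_bound[OF assms(3)] span by blast
  then show ?thesis by (simp add: card_image[OF inj])
qed

lemma in_span_bounded_degree:
  fixes h :: "('v, 'k::field) mpol"
  assumes "h \<in> carrier (mpol_ring V)" "\<And>k. k \<in> keys h \<Longrightarrow> mdeg k \<le> T"
  shows "h \<in> mpol_vs.span ((\<lambda>m. single m 1) ` {m. keys m \<subseteq> V \<and> mdeg m \<le> T})"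
proof -
  have "h = (\<Sum>m\<in>keys h. single 0 (lookup h m) * single m 1)"
    using sum_terms[of h] by (simp add: mult_single)
  moreover have "\<dots> \<in> mpol_vs.span ((\<lambda>m. single m 1) ` {m. keys m \<subseteq> V \<and> mdeg m \<le> T})"
    using assms
    by (intro mpol_vs.span_sum mpol_vs.span_scale mpol_vs.span_base) (auto simp: in_carrier_mpol)
  ultimately show ?thesis by simp
qed

text \<open>Passing to a smaller prime makes room for one more algebraically independent element g. In a relation
  modulo P between the products, the terms without g form a relation modulo Q, because g lies in Q; so
  they vanish. Then g can be cancelled, as P is prime and does not contain g.\<close>

lemma indep_mod_powers:
  fixes x :: "'i \<Rightarrow> ('v, 'k::field) mpol"
  assumes P: "primeideal P (mpol_ring V)" and Q: "ideal Q (mpol_ring V)" and sub: "P \<subseteq> Q"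
    and g: "g \<in> Q" "g \<notin> P"
    and J: "finite J" "\<And>j. j \<in> J \<Longrightarrow> x j \<in> carrier (mpol_ring V)"
    and x: "indep_mod Q J x"
  shows "indep_mod P ({..s} \<times> J) (\<lambda>(k, j). g ^ k * x j)"
proof -
  note gV = mpol_ideal_carrier[OF Q g(1)]
  have *: "\<forall>k\<le>s. \<forall>j\<in>J. c k j = 0"
    if "(\<Sum>k\<le>s. g ^ k * (\<Sum>j\<in>J. single 0 (c k j) * x j)) \<in> P" for c s
    using that
  proof (induction s arbitrary: c)
    case 0
    then show ?case using indep_modD[OF x, of "c 0"] sub by auto
  next
    case (Suc s)
    define y where "y k = (\<Sum>j\<in>J. single 0 (c k j) * x j)" for k
    define r where "r = (\<Sum>k\<le>s. g ^ k * y (Suc k))"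
    have yV: "y k \<in> carrier (mpol_ring V)" for k
      unfolding y_def by (intro mpol_sum_closed mpol_mult_closed mpol_const_closed J)
    have rV: "r \<in> carrier (mpol_ring V)"
      unfolding r_def by (intro mpol_sum_closed mpol_mult_closed mpol_power_closed gV yV)
    have eq: "(\<Sum>k\<le>Suc s. g ^ k * y k) = y 0 + g * r"
      unfolding r_def sum_distrib_left
      by (subst sum.atMost_Suc_shift) (simp add: mult.assoc)
    have in_P: "y 0 + g * r \<in> P" using Suc.prems unfolding y_def[symmetric] eq .
    moreover have "r * g \<in> Q" by (rule mpol_ideal_mult[OF Q g(1) rV])
    ultimately have "y 0 + g * r - r * g \<in> Q" using sub by (intro mpol_ideal_minus[OF Q]) auto
    then have "y 0 \<in> Q" by (simp add: mult.commute)
    then have c0: "\<forall>j\<in>J. c 0 j = 0" using indep_modD[OF x] unfolding y_def by blast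
    then have "y 0 = 0" by (simp add: y_def)
    then have "g * r \<in> P" using in_P by simp
    then have "r \<in> P" using mpol_prime_mult[OF P _ gV rV] g(2) by blast
    then have "\<forall>k\<le>s. \<forall>j\<in>J. c (Suc k) j = 0"
      using Suc.IH[of "\<lambda>k. c (Suc k)"] unfolding r_def y_def by blast
    then show ?case using c0 by (metis Suc_le_mono not0_implies_Suc)
  qed
  show ?thesis
    unfolding indep_mod_def
  proof (intro allI impI)
    fix c assume c: "(\<Sum>j\<in>{..s} \<times> J. single 0 (c j) * (case j of (k, j) \<Rightarrow> g ^ k * x j)) \<in> P"
    have "(\<Sum>j\<in>{..s} \<times> J. single 0 (c j) * (case j of (k, j) \<Rightarrow> g ^ k * x j))
        = (\<Sum>k\<le>s. g ^ k * (\<Sum>j\<in>J. single 0 (c (k, j)) * x j))"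
      unfolding sum_distrib_left sum.cartesian_product
      by (intro sum.cong) (auto simp: mult.left_commute)
    then show "\<forall>j\<in>{..s} \<times> J. c j = 0" using *[of "\<lambda>k j. c (k, j)"] c by auto
  qed
qed


section \<open>The length of a chain of prime ideals\<close>

lemma degree_bound_mult:
  fixes f g :: "('v, 'k::field) mpol"
  assumes "\<And>k. k \<in> keys f \<Longrightarrow> mdeg k \<le> a" "\<And>k. k \<in> keys g \<Longrightarrow> mdeg k \<le> b" "k \<in> keys (f * g)"
  shows "mdeg k \<le> a + b"
proof -
  obtain x y where "k = x + y" "x \<in> keys f" "y \<in> keys g" using assms(3) by (rule keys_multE)
  then show ?thesis using assms(1,2) by (simp add: mdeg_add add_mono)
qed

lemma degree_bound_power:
  fixes f :: "('v, 'k::field) mpol"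
  assumes "\<And>k. k \<in> keys f \<Longrightarrow> mdeg k \<le> a" "k \<in> keys (f ^ n)"
  shows "mdeg k \<le> n * a"
  using assms(2)
proof (induction n arbitrary: k)
  case (Suc n)
  have "mdeg k \<le> a + n * a"
    by (rule degree_bound_mult[of f a "f ^ n"]) (use Suc assms(1) in auto)
  then show ?case by simp
qed simp

text \<open>The starting point of the count: the monomials in B with all exponents at most s.\<close>

lemma indep_mod_monomials:
  fixes P :: "('v, 'k::field) mpol set"
  assumes B: "finite B" and P: "\<And>h. h \<in> carrier (mpol_ring B) \<Longrightarrow> h \<in> P \<Longrightarrow> h = 0"
  obtains X where "finite X" "X \<subseteq> carrier (mpol_ring B)" "card X = Suc s ^ card B"
    "indep_mod P X (\<lambda>x. x)" "\<And>h k. h \<in> X \<Longrightarrow> k \<in> keys h \<Longrightarrow> mdeg k \<le> s * card B"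
proof -
  define J where "J = B \<rightarrow>\<^sub>E {..s}"
  define mon where "mon \<phi> = (\<Sum>v\<in>B. single v (\<phi> v))" for \<phi> :: "'v \<Rightarrow> nat"
  have look: "lookup (mon \<phi>) v = (if v \<in> B then \<phi> v else 0)" for \<phi> v
    using B by (simp add: mon_def lookup_sum lookup_single when_def)
  have keys_mon: "keys (mon \<phi>) \<subseteq> B" for \<phi>
    using look by (auto simp: in_keys_iff split: if_splits)
  have inj: "inj_on mon J"
  proof (rule inj_onI)
    fix \<phi> \<psi> assume *: "\<phi> \<in> J" "\<psi> \<in> J" "mon \<phi> = mon \<psi>"
    have "\<phi> v = \<psi> v" if "v \<in> B" for v using look[of _ v] *(3) that by metis
    then show "\<phi> = \<psi>" using *(1,2) unfolding J_def by (intro PiE_ext)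
  qed
  have finJ: "finite J" unfolding J_def using B by (intro finite_PiE) auto
  let ?M = "mon ` J"
  let ?X = "(\<lambda>m. single m (1 :: 'k)) ` ?M"
  have injX: "inj_on (\<lambda>m. single m (1 :: 'k)) ?M"
    by (rule inj_onI) (metis keys_single singleton_inject zero_neq_one)
  have carr: "?X \<subseteq> carrier (mpol_ring B)" using keys_mon by (auto intro: mpol_single_closed)
  have "indep_mod P ?X (\<lambda>x. x)"
    unfolding indep_mod_def
  proof (intro allI impI ballI)
    fix c y assume c: "(\<Sum>x\<in>?X. single 0 (c x) * x) \<in> P" and "y \<in> ?X"
    then obtain m where m: "m \<in> ?M" "y = single m 1" by blast
    have "(\<Sum>x\<in>?X. single 0 (c x) * x) = 0"
      by (rule P[OF _ c]) (intro mpol_sum_closed mpol_mult_closed mpol_const_closed subsetD[OF carr])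
    then have "(\<Sum>m\<in>?M. single m (c (single m 1))) = 0"
      by (simp add: sum.reindex[OF injX] mult_single)
    then have "lookup (\<Sum>m\<in>?M. single m (c (single m 1))) m = 0" by simp
    then show "c y = 0" using m finJ by (simp add: lookup_sum lookup_single when_def)
  qed
  moreover have "card ?X = Suc s ^ card B"
    unfolding card_image[OF injX] card_image[OF inj] by (simp add: J_def card_PiE B)
  moreover have "mdeg k \<le> s * card B" if "h \<in> ?X" "k \<in> keys h" for h k
  proof -
    obtain \<phi> where \<phi>: "\<phi> \<in> J" "k = mon \<phi>" using \<open>h \<in> ?X\<close> \<open>k \<in> keys h\<close> by auto
    have "mdeg k = (\<Sum>v\<in>B. \<phi> v)"
      using mdeg_superset[OF B keys_mon] look by (simp add: \<phi>)
    also have "\<dots> \<le> (\<Sum>v\<in>B. s)" using \<phi>(1) by (intro sum_mono) (auto simp: J_def PiE_iff)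
    finally show ?thesis by (simp add: mult.commute)
  qed
  ultimately show thesis using that[of ?X] carr finJ by blast
qed

text \<open>Let g(i) be an element of the (i+1)-st prime outside the i-th. The products of powers of the g(i)
  and of the variables in B, with all exponents at most s, are linearly independent, their number is
  (s+1)^(|B|+m), and their degree is at most sK for a constant K. The polynomials of degree at most
  sK span a space of dimension at most (sK+1)^|V|, which is smaller for large s unless
  |B|+m is at most |V|.\<close>

theorem prime_chain_length:
  fixes C :: "nat \<Rightarrow> ('v, 'k::field) mpol set"
  assumes V: "finite V" and B: "B \<subseteq> V"
    and prime: "\<And>i. i \<le> m \<Longrightarrow> primeideal (C i) (mpol_ring V)"
    and chain: "\<And>i. i < m \<Longrightarrow> C i \<subset> C (Suc i)"
    and free: "\<And>h. h \<in> carrier (mpol_ring B) \<Longrightarrow> h \<in> C m \<Longrightarrow> h = 0"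
  shows "card B + m \<le> card V"
proof -
  have "\<forall>i<m. \<exists>g. g \<in> C (Suc i) \<and> g \<notin> C i" using chain by blast
  then obtain g where g: "\<And>i. i < m \<Longrightarrow> g i \<in> C (Suc i) \<and> g i \<notin> C i" by metis
  \<comment> \<open>any bound for the degree of g i will do; the sum also makes sense if g i = 0\<close>
  define a where "a i = (\<Sum>k\<in>keys (g i). mdeg k)" for i
  have a: "mdeg k \<le> a i" if "k \<in> keys (g i)" for i k
    unfolding a_def by (rule member_le_sum) (use that in auto)
  define K where "K = card B + (\<Sum>i<m. a i)"
  \<comment> \<open>then (s+1)^|V| (K+1)^|V| = (s+1)^|V| s is less than (s+1)^(|V|+1), as used at the end\<close>
  define s where "s = Suc K ^ card V"
  have fB: "finite B" using B V by (rule finite_subset)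
  have "\<exists>X. finite X \<and> X \<subseteq> carrier (mpol_ring V) \<and> card X = Suc s ^ (card B + (m - i)) \<and>
      indep_mod (C i) X (\<lambda>x. x) \<and>
      (\<forall>h\<in>X. \<forall>k\<in>keys h. mdeg k \<le> s * (card B + (\<Sum>j\<in>{i..<m}. a j)))" if "i \<le> m" for i
    using that
  proof (induction i rule: inc_induct)
    case base
    obtain X where X: "finite X" "X \<subseteq> carrier (mpol_ring B)" "card X = Suc s ^ card B"
      "indep_mod (C m) X (\<lambda>x. x)" "\<And>h k. h \<in> X \<Longrightarrow> k \<in> keys h \<Longrightarrow> mdeg k \<le> s * card B"
      using indep_mod_monomials[OF fB free] by blast
    moreover have "X \<subseteq> carrier (mpol_ring V)" using X(2) B by (force simp: in_carrier_mpol)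
    ultimately show ?case by auto
  next
    case (step i)
    then obtain X where X: "finite X" "X \<subseteq> carrier (mpol_ring V)"
      "card X = Suc s ^ (card B + (m - Suc i))" "indep_mod (C (Suc i)) X (\<lambda>x. x)"
      "\<And>h k. h \<in> X \<Longrightarrow> k \<in> keys h \<Longrightarrow> mdeg k \<le> s * (card B + (\<Sum>j\<in>{Suc i..<m}. a j))"
      by blast
    have i: "i < m" "i \<le> m" "Suc i \<le> m" using step.hyps by auto
    let ?J = "{..s} \<times> X" and ?x = "\<lambda>(k, h). g i ^ k * h"
    note Q = mpol_prime_ideal[OF prime[OF i(3)]]
    have ind: "indep_mod (C i) ?J ?x"
      using indep_mod_powers[OF prime[OF i(2)] Q _ _ _ X(1) _ X(4), of "g i" s] chain[OF i(1)] g[OF i(1)] X(2)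
      by blast
    have inj: "inj_on ?x ?J"
      by (rule indep_mod_inj[OF ind]) (use X(1) mpol_ideal_zero[OF mpol_prime_ideal[OF prime[OF i(2)]]] in auto)
    have gV: "g i \<in> carrier (mpol_ring V)" using mpol_ideal_carrier[OF Q] g[OF i(1)] by blast
    have fin: "finite (?x ` ?J)" using X(1) by simp
    have carr: "?x ` ?J \<subseteq> carrier (mpol_ring V)"
      using gV X(2) by (auto intro!: mpol_mult_closed mpol_power_closed)
    have card: "card (?x ` ?J) = Suc s ^ (card B + (m - i))"
    proof -
      have "card B + (m - i) = Suc (card B + (m - Suc i))" using i by simp
      then show ?thesis by (simp add: card_image[OF inj] card_cartesian_product X(3))
    qed
    have ind': "indep_mod (C i) (?x ` ?J) (\<lambda>x. x)"
      unfolding indep_mod_def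
    proof (intro allI impI)
      fix c assume "(\<Sum>y\<in>?x ` ?J. single 0 (c y) * y) \<in> C i"
      then have "(\<Sum>j\<in>?J. single 0 (c (?x j)) * ?x j) \<in> C i" by (simp add: sum.reindex[OF inj])
      then show "\<forall>y\<in>?x ` ?J. c y = 0" using indep_modD[OF ind, of "\<lambda>j. c (?x j)"] by blast
    qed
    have deg: "mdeg k \<le> s * (card B + (\<Sum>j\<in>{i..<m}. a j))"
      if hk: "h \<in> ?x ` ?J" "k \<in> keys h" for h k
    proof -
      obtain n h' where n: "n \<le> s" "h' \<in> X" "h = g i ^ n * h'" using hk(1) by auto
      have "mdeg k \<le> n * a i + s * (card B + (\<Sum>j\<in>{Suc i..<m}. a j))"
        by (rule degree_bound_mult[OF degree_bound_power[OF a] X(5)[OF n(2)] hk(2)[unfolded n(3)]])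
      also have "\<dots> \<le> s * a i + s * (card B + (\<Sum>j\<in>{Suc i..<m}. a j))" using n(1) by simp
      also have "\<dots> = s * (card B + (\<Sum>j\<in>{i..<m}. a j))"
        using i(1) by (simp add: sum.atLeast_Suc_lessThan[of i m] algebra_simps)
      finally show ?thesis .
    qed
    show ?case
      by (rule exI[of _ "?x ` ?J"]) (intro conjI ballI fin carr card ind' deg)
  qed
  from this[of 0] obtain X where X: "finite X" "X \<subseteq> carrier (mpol_ring V)"
    "card X = Suc s ^ (card B + m)" "indep_mod (C 0) X (\<lambda>x. x)"
    "\<And>h k. h \<in> X \<Longrightarrow> k \<in> keys h \<Longrightarrow> mdeg k \<le> s * K"
    by (auto simp: K_def atLeast0LessThan)
  let ?M = "{k. keys k \<subseteq> V \<and> mdeg k \<le> s * K}"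
  have "0 \<in> C 0" using mpol_ideal_zero[OF mpol_prime_ideal[OF prime]] by blast
  then have "indep_mod {0} X (\<lambda>x. x)" using X(4) unfolding indep_mod_def by auto
  then have "card X \<le> card ((\<lambda>k. single k (1 :: 'k)) ` ?M)"
    using X(1) by (rule card_le_of_independent)
      (use X(2,5) finite_monomials[OF V] in \<open>auto intro!: in_span_bounded_degree\<close>)
  also have "\<dots> \<le> card ?M" by (rule card_image_le[OF finite_monomials[OF V]])
  also have "\<dots> \<le> Suc (s * K) ^ card V" by (rule card_monomials[OF V])
  also have "\<dots> \<le> (Suc s * Suc K) ^ card V" by (intro power_mono) auto
  also have "\<dots> = Suc s ^ card V * s" unfolding power_mult_distrib s_def ..
  also have "\<dots> < Suc s ^ Suc (card V)" by simp
  finally have "Suc s ^ (card B + m) < Suc s ^ Suc (card V)" using X(3) by simp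
  then have "card B + m < Suc (card V)" by (rule power_less_imp_less_exp[rotated]) (simp add: s_def)
  then show ?thesis by simp
qed


section \<open>Height and number of generators\<close>

context coprime_leading
begin

text \<open>Walk down from P, discarding one generator of the regular sequence at each step.\<close>

lemma prime_chain_below:
  assumes "F \<subseteq> E" "primeideal P R" "gen F \<subseteq> P"
  shows "\<exists>C. (\<forall>i\<le>card F. primeideal (C i) R) \<and> (\<forall>i<card F. C i \<subset> C (Suc i)) \<and> C (card F) = P"
proof -
  have "finite F" using assms(1) finite_E by (rule finite_subset)
  then show ?thesis using assms
  proof (induction F arbitrary: P rule: finite_induct)
    case empty
    then show ?case by (intro exI[of _ "\<lambda>_. P"]) auto
  next
    case (insert e F)
    then have F: "F \<subseteq> E" and e: "e \<in> E" by auto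
    interpret R: cring R by (rule cring_mpol_ring)
    have "gen F \<subseteq> gen (insert e F)"
      unfolding gen_def[of F]
      by (rule mpol_Idl_minimal[OF f_image[OF F] gen_ideal]) (use insert.prems f_in_gen in auto)
    then have "gen F \<subseteq> P" using insert.prems(3) by blast
    then obtain Q where Q: "primeideal Q R" "gen F \<subseteq> Q" "Q \<subseteq> P" "f e \<notin> Q"
      using R.prime_below_nonzerodivisor[OF gen_ideal[OF F] insert.prems(2) _ f_carrier[OF e]]
        nonzerodivisor[OF F e insert.hyps(2)] by (metis mpol_ring_simps(2))
    obtain C where C: "\<forall>i\<le>card F. primeideal (C i) R" "\<forall>i<card F. C i \<subset> C (Suc i)" "C (card F) = Q"
      using insert.IH[OF F Q(1,2)] by blast
    have "f e \<in> P" using f_in_gen[OF insert.prems(1), of e] insert.prems(3) by auto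
    then have "Q \<subset> P" using Q by blast
    let ?C = "C(Suc (card F) := P)"
    have "card (insert e F) = Suc (card F)" using insert.hyps by simp
    moreover have "\<forall>i\<le>Suc (card F). primeideal (?C i) R"
      using C(1) insert.prems(2) by (auto simp: le_Suc_eq)
    moreover have "\<forall>i<Suc (card F). ?C i \<subset> ?C (Suc i)"
      using C(2,3) \<open>Q \<subset> P\<close> by (auto simp: less_Suc_eq)
    ultimately show ?case by (intro exI[of _ ?C]) simp
  qed
qed

lemma u_nonzero: "e \<in> E \<Longrightarrow> keys (u e) \<noteq> {}"
  using f_homogeneous[of e "u e"] f_lead[of e] D_pos by (auto simp: is_lead_def mdeg_def)

text \<open>The chosen variable a(e) divides u(e), so every leading monomial of a member of the ideal contains
  one of these variables. Hence no nonzero polynomial in the other variables B lies in the ideal, and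
  a prime ideal above it can be chosen that avoids all of them. There are |V| - r variables in B.\<close>

lemma prime_of_bounded_height:
  obtains P where "primeideal P R" "gen E \<subseteq> P"
    "prime_height R P \<le> enat (card E)"
proof -
  have "\<forall>e\<in>E. \<exists>v. v \<in> keys (u e)" using u_nonzero by blast
  then obtain a where a: "\<And>e. e \<in> E \<Longrightarrow> a e \<in> keys (u e)" by metis
  define B where "B = V - a ` E"
  have inj: "inj_on a E"
  proof (rule inj_onI, rule ccontr)
    fix e e' assume *: "e \<in> E" "e' \<in> E" "a e = a e'" "e \<noteq> e'"
    then show False using a[OF *(1)] a[OF *(2)] u_coprime[OF *(1,2,4)] by auto
  qed
  have "a ` E \<subseteq> V"
    using a f_carrier f_lead by (fastforce simp: in_carrier_mpol is_lead_def)
  then have card_B: "card V = card B + card E"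
    using card_Diff_subset[of "a ` E" V] card_mono[OF finite_V, of "a ` E"] finite_E finite_V
    by (simp add: B_def card_image[OF inj])
  have free: "h = 0" if hB: "h \<in> carrier (mpol_ring B)" and hE: "h \<in> gen E" for h
  proof (rule ccontr)
    assume "h \<noteq> 0"
    then obtain m where m: "is_lead h m" by (rule lead_exists)
    then obtain e where e: "e \<in> E" "mdvd (u e) m" using lead_of_gen[OF subset_refl hE m] by blast
    then have "lookup m (a e) \<noteq> 0" using a[OF e(1)] by (auto simp: mdvd_def in_keys_iff dest: spec[of _ "a e"])
    then have "a e \<in> keys m" by (simp add: in_keys_iff)
    then have "a e \<in> B" using hB m by (auto simp: in_carrier_mpol is_lead_def)
    then show False using e(1) by (simp add: B_def)
  qed
  interpret R: cring R by (rule cring_mpol_ring)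
  let ?T = "carrier (mpol_ring B) - {0 :: ('v, 'k) mpol}"
  obtain P where P: "primeideal P R" "gen E \<subseteq> P" "P \<inter> ?T = {}"
  proof (rule R.prime_ideal_avoiding[OF gen_ideal[OF subset_refl], of ?T])
    show "?T \<subseteq> carrier R" unfolding in_carrier_mpol subset_iff by (auto simp: in_carrier_mpol B_def)
    show "\<one>\<^bsub>R\<^esub> \<in> ?T" by simp
    show "x \<otimes>\<^bsub>R\<^esub> y \<in> ?T" if "x \<in> ?T" "y \<in> ?T" for x y
      using that by (auto intro: mpol_mult_closed)
    show "gen E \<inter> ?T = {}" using free by blast
  qed
  show thesis
  proof (rule that[OF P(1,2)])
    have "m \<le> card E"
      if "\<forall>i\<le>m. primeideal (C i) R" "\<forall>i<m. C i \<subset> C (Suc i)" "C m = P" for C m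
    proof -
      have "card B + m \<le> card V"
      proof (rule prime_chain_length[OF finite_V])
        show "B \<subseteq> V" by (auto simp: B_def)
        show "h = 0" if "h \<in> carrier (mpol_ring B)" "h \<in> C m" for h
          using that P(3) \<open>C m = P\<close> by auto
      qed (use that in simp_all)
      then show ?thesis using card_B by simp
    qed
    then show "prime_height R P \<le> enat (card E)"
      unfolding prime_height_def by (intro Sup_least) auto
  qed
qed

theorem height_gen: "ideal_height R (gen E) = enat (card E)"
proof (rule antisym)
  obtain P where P: "primeideal P R" "gen E \<subseteq> P" "prime_height R P \<le> enat (card E)"
    by (rule prime_of_bounded_height)
  have "ideal_height R (gen E) \<le> prime_height R P"
    unfolding ideal_height_def by (rule Inf_lower) (use P(1,2) in auto)
  then show "ideal_height R (gen E) \<le> enat (card E)" using P(3) by (rule order_trans)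
  show "enat (card E) \<le> ideal_height R (gen E)"
    unfolding ideal_height_def
  proof (rule Inf_greatest)
    fix x assume "x \<in> {prime_height R P | P. primeideal P R \<and> gen E \<subseteq> P}"
    then obtain P where P: "x = prime_height R P" "primeideal P R" "gen E \<subseteq> P" by auto
    show "enat (card E) \<le> x"
      unfolding P(1) prime_height_def
      by (rule Sup_upper) (use prime_chain_below[OF subset_refl P(2,3)] in auto)
  qed
qed

lemma ideal_order_ge: "ideal {h \<in> carrier R. \<forall>k\<in>keys h. d \<le> mdeg k} R" (is "ideal ?I R")
proof (rule mpol_idealI)
  fix g h assume gh: "g \<in> ?I"
  show "g + h \<in> ?I" if "h \<in> ?I"
    using gh that subsetD[OF Poly_Mapping.keys_add[of g h]] by (blast intro: mpol_add_closed)
  show "s * g \<in> ?I" if s: "s \<in> carrier R" for s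
  proof -
    have "d \<le> mdeg k" if k: "k \<in> keys (s * g)" for k
    proof -
      obtain x y where "k = x + y" "x \<in> keys s" "y \<in> keys g" using k by (rule keys_multE)
      then show ?thesis using gh by (auto simp: mdeg_add intro: trans_le_add2)
    qed
    then show ?thesis using gh s by (auto intro: mpol_mult_closed)
  qed
qed auto

text \<open>Otherwise 1 would lie in the ideal of the other generators, since f(e) is no zero divisor modulo it.\<close>

lemma f_not_in_gen_others:
  assumes "e \<in> E"
  shows "f e \<notin> gen (E - {e})"
proof
  assume "f e \<in> gen (E - {e})"
  then have one: "1 \<in> gen (E - {e})" using nonzerodivisor[of "E - {e}" e 1] assms by auto
  have "is_lead (1 :: ('v, 'k) mpol) 0" by (simp add: is_lead_def)
  then obtain e' where "e' \<in> E" "mdvd (u e') 0" using lead_of_gen[OF _ one] by blast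
  moreover from this(1) obtain v where "v \<in> keys (u e')" using u_nonzero by blast
  ultimately show False by (auto simp: mdvd_def in_keys_iff)
qed

text \<open>All members of the ideal have order at least D, so multiplying one of them by a polynomial s
  amounts, up to terms of order greater than D, to multiplying it by the constant term of s. Hence
  every member of the ideal agrees with a linear combination of A up to such terms. As the generators
  f(e) are homogeneous of degree D and linearly independent, the corresponding linear combinations of
  A are linearly independent.\<close>

lemma card_generators_ge:
  assumes A: "finite A" "A \<subseteq> carrier R" and eq: "gen E = Idl\<^bsub>R\<^esub> A"
  shows "card E \<le> card A"
proof -
  let ?I = "\<lambda>d. {h \<in> carrier R. \<forall>k\<in>keys h. d \<le> mdeg k}"
  let ?K = "{h \<in> carrier R. \<exists>g\<in>mpol_vs.span A. h - g \<in> ?I (Suc D)}"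
  note I = ideal_order_ge
  have "gen E \<subseteq> ?I D"
    unfolding gen_def by (rule mpol_Idl_minimal[OF f_image[OF subset_refl] I]) (use f_carrier f_homogeneous in auto)
  then have "A \<subseteq> ?I D" using mpol_Idl_self[OF A(2)] eq by blast
  have span: "g \<in> ?I D" if "g \<in> mpol_vs.span A" for g
    using that
  proof (induction rule: mpol_vs.span_induct_alt)
    case base then show ?case by simp
  next
    case (step c x y)
    then show ?case using \<open>A \<subseteq> ?I D\<close> by (intro mpol_ideal_add[OF I] mpol_ideal_mult[OF I]) auto
  qed
  have "ideal ?K R"
  proof (rule mpol_idealI)
    show "?K \<subseteq> carrier R" by blast
    show "0 \<in> ?K" using mpol_vs.span_zero[of A] by (auto intro!: bexI[of _ 0])
    fix h assume "h \<in> ?K"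
    then obtain g where g: "h \<in> carrier R" "g \<in> mpol_vs.span A" "h - g \<in> ?I (Suc D)" by blast
    show "h + h' \<in> ?K" if h': "h' \<in> ?K" for h'
    proof -
      obtain g' where g': "h' \<in> carrier R" "g' \<in> mpol_vs.span A" "h' - g' \<in> ?I (Suc D)" using h' by blast
      have "(h + h') - (g + g') = (h - g) + (h' - g')" by simp
      also have "\<dots> \<in> ?I (Suc D)" by (rule mpol_ideal_add[OF I g(3) g'(3)])
      finally show ?thesis
        using mpol_add_closed[OF g(1) g'(1)] mpol_vs.span_add[OF g(2) g'(2)] by blast
    qed
    show "s * h \<in> ?K" if s: "s \<in> carrier R" for s
    proof -
      define s' where "s' = s - single 0 (lookup s 0)"
      have s': "s' \<in> carrier R" unfolding s'_def by (intro mpol_minus_closed s mpol_const_closed)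
      have "s' * g \<in> ?I (Suc D)"
      proof -
        have "Suc D \<le> mdeg k" if k: "k \<in> keys (s' * g)" for k
        proof -
          obtain x y where xy: "k = x + y" "x \<in> keys s'" "y \<in> keys g" using k by (rule keys_multE)
          have "x \<noteq> 0" using xy(2) by (auto simp: s'_def in_keys_iff lookup_minus)
          then have "mdeg x \<ge> 1" using mdeg_eq_0[of x] by simp
          moreover have "D \<le> mdeg y" using span[OF g(2)] xy(3) by simp
          ultimately show ?thesis by (simp add: xy(1) mdeg_add)
        qed
        then show ?thesis using s' span[OF g(2)] by (auto intro: mpol_mult_closed)
      qed
      moreover have "s * (h - g) \<in> ?I (Suc D)" by (rule mpol_ideal_mult[OF I g(3) s])
      ultimately have "s * (h - g) + s' * g \<in> ?I (Suc D)" by (rule mpol_ideal_add[OF I, rotated])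
      moreover have "s * (h - g) + s' * g = s * h - single 0 (lookup s 0) * g"
        by (simp add: s'_def algebra_simps)
      ultimately have "s * h - single 0 (lookup s 0) * g \<in> ?I (Suc D)" by simp
      then show ?thesis using mpol_vs.span_scale[OF g(2)] mpol_mult_closed[OF s g(1)] by blast
    qed
  qed
  moreover have "A \<subseteq> ?K"
  proof
    fix x assume "x \<in> A"
    then show "x \<in> ?K" using A(2) mpol_vs.span_base[of x A] by (auto intro!: bexI[of _ x])
  qed
  ultimately have K: "gen E \<subseteq> ?K" unfolding eq by (rule mpol_Idl_minimal[OF A(2)])
  have "\<forall>e\<in>E. \<exists>g. g \<in> mpol_vs.span A \<and> f e - g \<in> ?I (Suc D)"
    using subsetD[OF K f_in_gen[OF subset_refl]] by auto
  from bchoice[OF this] obtain g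
    where "\<forall>e\<in>E. g e \<in> mpol_vs.span A \<and> f e - g e \<in> ?I (Suc D)" ..
  then have g: "g e \<in> mpol_vs.span A" "f e - g e \<in> ?I (Suc D)" if "e \<in> E" for e
    using that by simp_all
  have "indep_mod {0} E g"
    unfolding indep_mod_def
  proof (intro allI impI ballI)
    fix c e assume c: "(\<Sum>e\<in>E. single 0 (c e) * g e) \<in> {0}" and e: "e \<in> E"
    let ?h = "\<Sum>e\<in>E. single 0 (c e) * f e"
    have "?h = (\<Sum>e\<in>E. single 0 (c e) * (f e - g e))"
      using c by (simp add: right_diff_distrib sum_subtractf)
    also have "\<dots> \<in> ?I (Suc D)"
      by (intro mpol_ideal_sum[OF I] mpol_ideal_mult[OF I] g mpol_const_closed)
    finally have high: "Suc D \<le> mdeg k" if "k \<in> keys ?h" for k using that by blast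
    have low: "mdeg k \<le> D" if "k \<in> keys ?h" for k
    proof -
      have "(\<Sum>e\<in>E. lookup (single 0 (c e) * f e) k) \<noteq> 0"
        using that by (simp add: in_keys_iff lookup_sum)
      then obtain e where e: "e \<in> E" "lookup (single 0 (c e) * f e) k \<noteq> 0"
        by (rule sum.not_neutral_contains_not_neutral)
      from e(2) have "k \<in> keys (single 0 (c e) * f e)" by (simp add: in_keys_iff)
      then obtain x y where xy: "k = x + y" "x \<in> keys (single 0 (c e))" "y \<in> keys (f e)"
        by (rule keys_multE)
      then show ?thesis using f_homogeneous[OF e(1) xy(3)] by (simp split: if_splits)
    qed
    have "keys ?h = {}"
    proof (rule equals0I)
      fix k assume "k \<in> keys ?h"
      from high[OF this] low[OF this] show False by simp
    qed
    then have "?h = 0" by simp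
    show "c e = 0"
    proof (rule ccontr)
      assume "c e \<noteq> 0"
      let ?r = "\<Sum>e'\<in>E - {e}. single 0 (c e') * f e'"
      have "single 0 (c e) * f e = - ?r"
        using \<open>?h = 0\<close> finite_E e by (simp add: sum.remove eq_neg_iff_add_eq_0)
      then have "single 0 (inverse (c e)) * (single 0 (c e) * f e) = single 0 (inverse (c e)) * (- ?r)"
        by simp
      then have "f e = single 0 (inverse (c e)) * (- ?r)"
        using \<open>c e \<noteq> 0\<close> by (simp add: mult_single single_one flip: mult.assoc)
      also have "\<dots> \<in> gen (E - {e})"
      proof -
        have sub: "E - {e} \<subseteq> E" by blast
        note J = gen_ideal[OF sub]
        show ?thesis
          by (intro mpol_ideal_mult[OF J] mpol_ideal_uminus[OF J] mpol_ideal_sum[OF J]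
              f_in_gen[OF sub] mpol_const_closed)
      qed
      finally show False using f_not_in_gen_others[OF e] by contradiction
    qed
  qed
  then show ?thesis using finite_E A(1) g(1) by (rule card_le_of_independent)
qed

theorem min_num_gens_gen: "min_num_gens R (gen E) = enat (card E)"
proof (rule antisym)
  have "min_num_gens R (gen E) \<le> enat (card (f ` E))"
    unfolding min_num_gens_def gen_def
    by (intro Inf_lower) (use finite_E f_image[OF subset_refl] in blast)
  also have "\<dots> \<le> enat (card E)" using card_image_le[OF finite_E] by simp
  finally show "min_num_gens R (gen E) \<le> enat (card E)" .
  show "enat (card E) \<le> min_num_gens R (gen E)"
    unfolding min_num_gens_def by (rule Inf_greatest) (auto intro: card_generators_ge)
qed

theorem gen_radical_ideal: "radical_ideal R (gen E)"
proof -
  note I = gen_ideal[OF subset_refl]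
  have "radical_of R (gen E) = gen E"
  proof (intro equalityI subsetI)
    fix h assume "h \<in> radical_of R (gen E)"
    then obtain N where "h \<in> carrier R" "h ^ N \<in> gen E"
      by (auto simp: radical_of_def mpol_nat_pow)
    then show "h \<in> gen E" by (rule gen_radical)
  next
    fix h assume h: "h \<in> gen E"
    then show "h \<in> radical_of R (gen E)"
      unfolding radical_of_def using mpol_ideal_carrier[OF I h]
      by (auto simp: mpol_nat_pow intro!: exI[of _ 1])
  qed
  then show ?thesis using I by (simp add: radical_ideal_def)
qed

theorem gen_complete_intersection: "complete_intersection R (gen E)"
  using gen_ideal[OF subset_refl] height_gen min_num_gens_gen
  by (simp add: complete_intersection_def)

end


section \<open>Monomial orders refining a vector of weights\<close>

text \<open>Finitely supported vectors are ordered by the first index at which they differ. Thus a positive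
  entry at index q beats any entry at a later index, and beats a negative entry at an index up to q.\<close>

lemma single_less_single:
  fixes x y :: real and p q :: nat
  assumes "0 < x" "p \<le> q \<Longrightarrow> y < 0"
  shows "single p y < single q x"
proof (cases "p \<le> q")
  case True
  then show ?thesis using assms
    unfolding less_poly_mapping.rep_eq less_fun_def
    by (intro exI[of _ p]) (auto simp: lookup_single when_def)
next
  case False
  then show ?thesis using assms
    unfolding less_poly_mapping.rep_eq less_fun_def
    by (intro exI[of _ q]) (auto simp: lookup_single when_def)
qed

text \<open>The weight of a variable is a vector of real numbers, compared lexicographically, which spares the
  choice of large constants that would combine several weights into one.\<close>

definition weight :: "('v \<Rightarrow> nat \<Rightarrow>\<^sub>0 real) \<Rightarrow> ('v \<Rightarrow>\<^sub>0 nat) \<Rightarrow> nat \<Rightarrow>\<^sub>0 real" where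
  "weight W m = (\<Sum>v\<in>keys m. of_nat (lookup m v) * W v)"

lemma weight_add: "weight W (a + b) = weight W a + weight W b"
proof -
  have *: "weight W m = (\<Sum>v\<in>keys a \<union> keys b. of_nat (lookup m v) * W v)"
    if "keys m \<subseteq> keys a \<union> keys b" for m
    unfolding weight_def using that by (intro sum.mono_neutral_left) (auto simp: in_keys_iff)
  show ?thesis
    by (simp add: * Poly_Mapping.keys_add lookup_add distrib_right sum.distrib)
qed

lemma weight_single [simp]: "weight W (single v 1) = W v"
  by (simp add: weight_def)

text \<open>Ties between the weights are broken by the lexicographic order on monomials.\<close>

definition weight_order :: "('v \<Rightarrow> nat \<Rightarrow>\<^sub>0 real) \<Rightarrow> ('v \<Rightarrow>\<^sub>0 nat) \<Rightarrow> (nat \<Rightarrow>\<^sub>0 real) \<times> ('v \<Rightarrow>\<^sub>0 nat)" where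
  "weight_order W m = (weight W m, m)"

lemma monomial_order_weight_order:
  "monomial_order (weight_order W :: ('v::linorder \<Rightarrow>\<^sub>0 nat) \<Rightarrow> _)"
proof
  show "a = b" if "weight_order W a = weight_order W b" for a b :: "'v \<Rightarrow>\<^sub>0 nat"
    using that by (simp add: weight_order_def)
  show "weight_order W (a + c) < weight_order W (b + c)"
    if "weight_order W a < weight_order W b" for a b c :: "'v \<Rightarrow>\<^sub>0 nat"
    using that by (auto simp: weight_order_def less_prod_def weight_add)
qed


section \<open>The generators of the twisted LSS-ideal\<close>

text \<open>The two monomials of block q in the generator of the edge {i, j} are those with (a, b) = (i, j) and
  with (a, b) = (j, i).\<close>

definition edge_mono :: "nat \<Rightarrow> nat \<Rightarrow> nat \<Rightarrow> (nat \<times> nat) \<Rightarrow>\<^sub>0 nat" where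
  "edge_mono a b q = single (a, 2*q-1) 1 + single (b, 2*q) 1"

lemma keys_edge_mono: "keys (edge_mono a b q) = {(a, 2*q-1), (b, 2*q)}"
  by (simp add: edge_mono_def keys_add_nat insert_commute)

lemma edge_mono_inj:
  assumes "q \<ge> 1" "q' \<ge> 1"
  shows "edge_mono a b q = edge_mono a' b' q' \<longleftrightarrow> a = a' \<and> b = b' \<and> q = q'"
proof
  assume "edge_mono a b q = edge_mono a' b' q'"
  then have *: "{(a, 2*q-1), (b, 2*q)} = {(a', 2*q'-1), (b', 2*q')}"
    by (metis keys_edge_mono)
  have "2*q-1 \<noteq> 2*q'" using assms by presburger
  with * show "a = a' \<and> b = b' \<and> q = q'"
    using assms by (auto simp: doubleton_eq_iff)
qed simp

lemma mdeg_edge_mono: "mdeg (edge_mono a b q) = 2"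
  by (simp add: edge_mono_def mdeg_add)

lemma lookup_edge_mono_le: 
  assumes "q \<ge> 1"
  shows "lookup (edge_mono a b q) v \<le> 1"
  using assms by (auto simp: edge_mono_def lookup_add lookup_single when_def)

lemma lss_gen_terms:
  "lss_gen d i j = (\<Sum>q = 1..d. single (edge_mono i j q) 1 - single (edge_mono j i q) (1 :: 'k::field))"
  by (simp add: lss_gen_def pvar_def edge_mono_def mult_single add.commute)

lemma keys_lss_gen:
  assumes "m \<in> keys (lss_gen d i j :: (nat \<times> nat, 'k::field) mpol)"
  obtains a b q where "q \<in> {1..d}" "(a, b) = (i, j) \<or> (a, b) = (j, i)" "m = edge_mono a b q"
proof -
  have "(\<Sum>q = 1..d. lookup (single (edge_mono i j q) 1 - single (edge_mono j i q) (1 :: 'k)) m) \<noteq> 0"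
    using assms by (simp add: in_keys_iff lss_gen_terms lookup_sum)
  then obtain q where q: "q \<in> {1..d}"
      "lookup (single (edge_mono i j q) 1 - single (edge_mono j i q) (1 :: 'k)) m \<noteq> 0"
    by (rule sum.not_neutral_contains_not_neutral)
  then have "m = edge_mono i j q \<or> m = edge_mono j i q"
    by (auto simp: lookup_minus lookup_single when_def split: if_splits)
  then show thesis using that q(1) by blast
qed

lemma edge_mono_in_lss_gen:
  assumes "i \<noteq> j" "q \<in> {1..d}" "(a, b) = (i, j) \<or> (a, b) = (j, i)"
  shows "edge_mono a b q \<in> keys (lss_gen d i j :: (nat \<times> nat, 'k::field) mpol)"
proof -
  have "lookup (lss_gen d i j :: (nat \<times> nat, 'k) mpol) (edge_mono a b q)
      = (\<Sum>r = 1..d. if r = q then (if (a, b) = (i, j) then 1 else - 1) else 0)"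
    unfolding lss_gen_terms lookup_sum using assms
    by (intro sum.cong) (auto simp: lookup_minus lookup_single when_def edge_mono_inj)
  then show ?thesis using assms(2) by (simp add: in_keys_iff)
qed


section \<open>Leading monomials from a twisted positive matching decomposition\<close>

text \<open>The order of the two ends tells which of the two matchings of block q an edge of H(q) comes from.\<close>

lemma H_edges_iff:
  assumes "q \<ge> 1"
  shows "{(x, 2*q-1), (y, 2*q)} \<in> H_edges M q \<longleftrightarrow>
    x < y \<and> {x, y} \<in> M (2*q-1) \<or> y < x \<and> {x, y} \<in> M (2*q)"
proof -
  have "2*q-1 \<noteq> 2*q" using assms by simp
  then show ?thesis by (auto simp: H_edges_def doubleton_eq_iff insert_commute)
qed

locale tpm_decomposition =
  fixes n :: nat and E :: "nat set set" and p :: nat and M :: "nat \<Rightarrow> nat set set"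
    and w :: "nat \<Rightarrow> nat \<times> nat \<Rightarrow> real"
  assumes graph: "graph_on n E"
    and decomp: "twisted_matching_decomp E p M"
    and positive: "q \<in> {1..p} \<Longrightarrow> twisted_positive_map n E M q (w q)"
begin

definition edges :: "(nat \<times> nat) set" where
  "edges = {(i, j). i < j \<and> {i, j} \<in> E}"

text \<open>The index of the matching that contains the edge; it is unique because the matchings are disjoint.\<close>

definition part :: "nat \<times> nat \<Rightarrow> nat" where
  "part e = (SOME l. l \<in> {1..2*p} \<and> {fst e, snd e} \<in> M l)"

definition block :: "nat \<times> nat \<Rightarrow> nat" where
  "block e = (part e + 1) div 2"

text \<open>The edge of H(q) that belongs to the edge e joins fst (orient e) in column 2q-1 to
  snd (orient e) in column 2q.\<close>

definition orient :: "nat \<times> nat \<Rightarrow> nat \<times> nat" where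
  "orient e = (if odd (part e) then e else (snd e, fst e))"

definition lead :: "nat \<times> nat \<Rightarrow> (nat \<times> nat) \<Rightarrow>\<^sub>0 nat" where
  "lead e = edge_mono (fst (orient e)) (snd (orient e)) (block e)"

text \<open>The variable in row i and column l belongs to block (l + 1) div 2, and its weight has an entry only
  there.\<close>

definition var_weight :: "nat \<times> nat \<Rightarrow> nat \<Rightarrow>\<^sub>0 real" where
  "var_weight v = (let q = (snd v + 1) div 2 in single q (w q v))"

lemma edges_bounds:
  assumes "(i, j) \<in> edges"
  shows "i \<in> {1..n}" "j \<in> {1..n}" "i < j" "{i, j} \<in> E"
  using assms graph by (auto simp: edges_def graph_on_def)

lemma finite_edges: "finite edges"
proof (rule finite_subset)
  show "edges \<subseteq> {1..n} \<times> {1..n}" using edges_bounds(1,2) by (intro subrelI SigmaI)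
qed simp

lemma part:
  assumes "(i, j) \<in> edges"
  shows "part (i, j) \<in> {1..2*p}" "{i, j} \<in> M (part (i, j))"
proof -
  have "\<exists>l. l \<in> {1..2*p} \<and> {fst (i, j), snd (i, j)} \<in> M l"
    using edges_bounds(4)[OF assms] decomp by (auto simp: twisted_matching_decomp_def)
  from someI_ex[OF this] show "part (i, j) \<in> {1..2*p}" "{i, j} \<in> M (part (i, j))"
    by (simp_all add: part_def)
qed

lemma part_unique:
  assumes "(i, j) \<in> edges" "l \<in> {1..2*p}" "{i, j} \<in> M l"
  shows "l = part (i, j)"
  using decomp part[OF assms(1)] assms(2,3)
  unfolding twisted_matching_decomp_def disjoint_family_on_def by blast

lemma block:
  assumes "(i, j) \<in> edges"
  shows "block (i, j) \<in> {1..p}"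
    and "part (i, j) = (if odd (part (i, j)) then 2 * block (i, j) - 1 else 2 * block (i, j))"
  using part(1)[OF assms] by (auto simp: block_def elim!: oddE evenE)

lemma weight_edge_mono:
  assumes "q \<ge> 1"
  shows "weight var_weight (edge_mono a b q) = single q (w q (a, 2*q-1) + w q (b, 2*q))"
proof -
  have "(2*q - 1 + 1) div 2 = q" "(2*q + 1) div 2 = q" using assms by auto
  then show ?thesis
    by (simp add: edge_mono_def weight_add var_weight_def Let_def single_add del: One_nat_def)
qed

lemma lead_weight_pos:
  assumes e: "(i, j) \<in> edges" and or: "orient (i, j) = (a, b)" and q: "q = block (i, j)"
  shows "w q (a, 2*q-1) + w q (b, 2*q) > 0" "w q (b, 2*q-1) + w q (a, 2*q) < 0"
proof -
  note b = edges_bounds[OF e]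
  have "{(a, 2*q-1), (b, 2*q)} \<in> H_edges M q"
    using block[OF e] part(2)[OF e] b(3) or q
    by (subst H_edges_iff) (auto simp: orient_def insert_commute split: if_splits)
  moreover have "a \<in> {1..n}" "b \<in> {1..n}" "a \<noteq> b"
    using b or by (auto simp: orient_def split: if_splits)
  moreover have "twisted_positive_map n E M q (w q)" using positive block(1)[OF e] q by blast
  ultimately show "w q (a, 2*q-1) + w q (b, 2*q) > 0" "w q (b, 2*q-1) + w q (a, 2*q) < 0"
    unfolding twisted_positive_map_def by blast+
qed

text \<open>The edge is in no matching with index at most 2q, so the mapping on H(q) treats it as an edge that is
  still left over, and gives both of its monomials a negative weight.\<close>

lemma earlier_weight_neg:
  assumes e: "(i, j) \<in> edges" and q: "1 \<le> q" "q < block (i, j)"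
    and ab: "(a, b) = (i, j) \<or> (a, b) = (j, i)"
  shows "w q (a, 2*q-1) + w q (b, 2*q) < 0"
proof -
  note b = edges_bounds[OF e]
  have qp: "q \<in> {1..p}" using block(1)[OF e] q by auto
  have late: "{i, j} \<notin> M l" if "1 \<le> l" "l \<le> 2 * q" for l
  proof
    assume "{i, j} \<in> M l"
    then have "l = part (i, j)" using part_unique[OF e] that qp by auto
    then show False using that q by (auto simp: block_def)
  qed
  have "{i, j} \<in> E - (\<Union>k\<in>{1..2*(q-1)}. M k)" using b(4) late by auto
  moreover have "{(i, 2*q-1), (j, 2*q)} \<notin> H_edges M q" "{(j, 2*q-1), (i, 2*q)} \<notin> H_edges M q"
    unfolding H_edges_iff[OF q(1)]
    using late[of "2*q-1"] late[of "2*q"] q(1) by (simp_all add: insert_commute)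
  ultimately have "w q (i, 2*q-1) + w q (j, 2*q) < 0 \<and> w q (j, 2*q-1) + w q (i, 2*q) < 0"
    using positive[OF qp, unfolded twisted_positive_map_def, THEN bspec, OF b(1), THEN bspec, OF b(2)]
      b(3) by simp
  then show ?thesis using ab by auto
qed

text \<open>A common variable forces the two edges into the same block q. If they lie in the same matching, they
  are disjoint or equal. If {i, j} lies in M(2q-1) and {i', j'} in M(2q), with i < j and i' < j', a
  common variable means i = j' or j = i', and both are excluded by the definition of a twisted matching
  decomposition.\<close>

lemma leads_coprime:
  assumes e: "(i, j) \<in> edges" "(i', j') \<in> edges" "(i, j) \<noteq> (i', j')"
  shows "keys (lead (i, j)) \<inter> keys (lead (i', j')) = {}"
proof (rule ccontr)
  assume meet: "keys (lead (i, j)) \<inter> keys (lead (i', j')) \<noteq> {}"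
  obtain a b where ab: "orient (i, j) = (a, b)" by fastforce
  obtain a' b' where ab': "orient (i', j') = (a', b')" by fastforce
  let ?q = "block (i, j)" and ?q' = "block (i', j')"
  have q: "?q \<in> {1..p}" "?q' \<ge> 1" using block(1)[OF e(1)] block(1)[OF e(2)] by auto
  then have odd_even: "2 * ?q - 1 \<noteq> 2 * ?q'" "2 * ?q' - 1 \<noteq> 2 * ?q" by (auto, presburger+)
  have qq: "?q' = ?q" and share: "a = a' \<or> b = b'"
    using meet odd_even q by (auto simp: lead_def keys_edge_mono ab ab')
  have twisted: "\<And>i j. i < j \<Longrightarrow> {i, j} \<in> M (2 * ?q - 1) \<Longrightarrow>
      (\<forall>k1<i. {k1, i} \<notin> M (2 * ?q)) \<and> (\<forall>k2>j. {j, k2} \<notin> M (2 * ?q))"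
    using decomp q(1) unfolding twisted_matching_decomp_def by blast
  note b = edges_bounds[OF e(1)] and b' = edges_bounds[OF e(2)]
  note M = part(2)[OF e(1)] and M' = part(2)[OF e(2)]
  note bl = block(2)[OF e(1)] and bl' = block(2)[OF e(2), unfolded qq]
  show False
  proof (cases "odd (part (i, j)) = odd (part (i', j'))")
    case True
    then have "part (i, j) = part (i', j')" using bl bl' by auto
    moreover have "matching (M (part (i, j)))"
      using decomp part(1)[OF e(1)] unfolding twisted_matching_decomp_def by blast
    moreover have "{i, j} \<noteq> {i', j'}" using e(3) b(3) b'(3) by (auto simp: doubleton_eq_iff)
    ultimately have "{i, j} \<inter> {i', j'} = {}"
      using M M' unfolding matching_def pairwise_def disjnt_def by metis
    then show False using share ab ab' by (auto simp: orient_def split: if_splits)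
  next
    case False
    show False
    proof (cases "odd (part (i, j))")
      case True
      then have "part (i, j) = 2 * ?q - 1" "part (i', j') = 2 * ?q" using False bl bl' by auto
      moreover have "i = j' \<or> j = i'"
        using True False share ab ab' by (auto simp: orient_def)
      ultimately show False using twisted[OF b(3)] M M' b'(3) by auto
    next
      case even: False
      then have "part (i, j) = 2 * ?q" "part (i', j') = 2 * ?q - 1" using False bl bl' by auto
      moreover have "i' = j \<or> j' = i"
        using even False share ab ab' by (auto simp: orient_def)
      ultimately show False using twisted[OF b'(3)] M M' b(3) by auto
    qed
  qed
qed

lemma coprime_leading_lss_gen:
  assumes "p \<le> d"
  shows "coprime_leading (weight_order var_weight) ({1..n} \<times> {1..2*d}) edges
    (\<lambda>(i, j). lss_gen d i j :: (nat \<times> nat, 'k::field) mpol) lead 2"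
proof (rule coprime_leading.intro[OF monomial_order_weight_order], unfold_locales)
  let ?f = "\<lambda>(i, j). lss_gen d i j :: (nat \<times> nat, 'k) mpol"
  interpret monomial_order "weight_order var_weight" by (rule monomial_order_weight_order)
  show "finite ({1..n} \<times> {1..2*d})" by simp
  show "finite edges" by (rule finite_edges)
  show "(2 :: nat) > 0" by simp
  fix e assume e: "e \<in> edges"
  obtain i j where ij: "e = (i, j)" by fastforce
  note eij = e[unfolded ij]
  note b = edges_bounds[OF eij]
  obtain x y where xy: "orient (i, j) = (x, y)" by fastforce
  have xy_cases: "(x, y) = (i, j) \<or> (x, y) = (j, i)" using xy by (auto simp: orient_def split: if_splits)
  let ?q = "block (i, j)"
  have q: "?q \<ge> 1" "?q \<in> {1..d}" using block(1)[OF eij] assms by auto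
  have lead: "lead e = edge_mono x y ?q" by (simp add: lead_def ij xy)
  show "?f e \<in> carrier (mpol_ring ({1..n} \<times> {1..2*d}))"
    using lss_gen_in_S_ring[OF b(1,2)] by (simp add: ij S_ring_def)
  show "lookup (lead e) v \<le> 1" for v unfolding lead by (rule lookup_edge_mono_le[OF q(1)])
  show "mdeg m = 2" if "m \<in> keys (?f e)" for m
    using that unfolding ij prod.case by (rule keys_lss_gen) (simp add: mdeg_edge_mono)
  show "keys (lead e) \<inter> keys (lead e') = {}" if "e' \<in> edges" "e \<noteq> e'" for e'
    using leads_coprime[OF eij, of "fst e'" "snd e'"] that by (simp add: ij)
  show "is_lead (?f e) (lead e)"
    unfolding is_lead_def ij prod.case
  proof (intro conjI ballI impI)
    show "lead (i, j) \<in> keys (lss_gen d i j :: (nat \<times> nat, 'k) mpol)"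
      using edge_mono_in_lss_gen[OF _ q(2) xy_cases] b(3) lead ij by simp
    fix k assume k: "k \<in> keys (lss_gen d i j :: (nat \<times> nat, 'k) mpol)" "k \<noteq> lead (i, j)"
    obtain x' y' r where r: "r \<in> {1..d}" "(x', y') = (i, j) \<or> (x', y') = (j, i)" "k = edge_mono x' y' r"
      using k(1) by (rule keys_lss_gen)
    have "w r (x', 2*r-1) + w r (y', 2*r) < 0" if "r \<le> ?q"
    proof (cases "r = ?q")
      case True
      then have "(x', y') \<noteq> (x, y)" using k(2) r(3) lead ij by auto
      then have "x' = y \<and> y' = x" using r(2) xy_cases by auto
      then show ?thesis using lead_weight_pos(2)[OF eij xy True] by simp
    next
      case False
      then show ?thesis using earlier_weight_neg[OF eij _ _ r(2)] r(1) that by auto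
    qed
    then have "weight var_weight k < weight var_weight (edge_mono x y ?q)"
      using lead_weight_pos(1)[OF eij xy refl] r(1) q(1)
      by (simp add: r(3) weight_edge_mono single_less_single del: One_nat_def)
    then show "weight_order var_weight k < weight_order var_weight (lead (i, j))"
      using lead ij by (simp add: weight_order_def less_prod_def)
  qed
qed

end

section \<open>Radicality and complete intersection\<close>

theorem theorem2p15:
  fixes n d :: nat and E :: "nat set set"
  assumes "graph_on n E"
    and "d \<ge> 1"
    and "d \<ge> tpmd n E"
  shows "radical_ideal (S_ring n d :: (nat \<times> nat, 'k::field) mpol ring) (twisted_lss_ideal n E d)
    \<and> complete_intersection (S_ring n d :: (nat \<times> nat, 'k) mpol ring) (twisted_lss_ideal n E d)"
proof -
  let ?p = "tpmd n E"
  have "admits_tpmd n E ?p"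
    unfolding tpmd_def using admits_tpmd_exists[OF assms(1)] by (rule LeastI_ex)
  then obtain M where M: "twisted_matching_decomp E ?p M"
    and "\<forall>q\<in>{1..?p}. \<exists>w. twisted_positive_map n E M q w"
    unfolding admits_tpmd_def by blast
  from bchoice[OF this(2)] obtain w where w: "\<forall>q\<in>{1..?p}. twisted_positive_map n E M q (w q)" ..
  interpret tpm_decomposition n E ?p M w
    using assms(1) M w by unfold_locales auto
  interpret coprime_leading "weight_order var_weight" "{1..n} \<times> {1..2*d}" edges
      "\<lambda>(i, j). lss_gen d i j :: (nat \<times> nat, 'k) mpol" lead 2
    by (rule coprime_leading_lss_gen[OF assms(3)])
  have "(\<lambda>(i, j). lss_gen d i j :: (nat \<times> nat, 'k) mpol) ` edges
      = {lss_gen d i j | i j. i < j \<and> {i, j} \<in> E}"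
    by (auto simp: edges_def)
  then have "twisted_lss_ideal n E d = gen edges"
    by (simp only: twisted_lss_ideal_def gen_def S_ring_def)
  then show ?thesis
    using gen_radical_ideal gen_complete_intersection by (simp only: S_ring_def)
qed

end
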